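(* For every environment $\Gamma=(c,\mu)$ and every $\varepsilon>0$, there is $\Delta>0$ such that for any finite price grid of size $\Delta$, there is a finite information structure inducing a game whose set of sequential equilibrium payoff pairs is an $\varepsilon$-net of the set $\{(\pi_b,\pi_s):\pi_b\ge0,\ \pi_s\ge\underline{\pi}_s(\Gamma),\ \pi_b+\pi_s\le S(\Gamma)\}$.
   Context: Environment: $V\subset\mathbb{R}$ is compact with $\underline v=\min V<\max V=\overline v$; $\mu$ is a probability measure with support $V$; $c:V\to\mathbb{R}$ is continuous with $v-c(v)\ge0$ for all $v\in V$ and $\mathbb{E}_\mu[v-c(v)]>0$. $S(\Gamma)=\mathbb{E}[v-c(v)]$, $\underline{\pi}_s(\Gamma)=\max\{\underline v-\mathbb{E}[c(v)],0\}$. A finite information structure consists of finite signal sets $T_s,T_b$ and a probability distribution $P$ on $T_s\times T_b\times V$ with $V$-marginal $\mu$. Game: $(t_s,t_b,v)\sim P$; Seller observes $t_s$ and posts a price $p$ from the price set; Buyer observes $t_b$ and $p$ and accepts or rejects; acceptance gives Buyer $v-p$ and Seller $p-c(v)$, rejection gives both $0$. A finite price grid of size $\Delta$ is a finite set of prices whose minimum is at most $\underline v$, whose maximum is at least $\overline v$, and in which any two consecutive prices differ by at most $\Delta$. Sequential equilibrium (Kreps–Wilson) is taken in the induced finite game in which Nature directly draws $(t_b,t_s)$ from the marginal of $P$ and the payoffs from trade at price $p$ are $(\mathbb{E}[v|t_b,t_s]-p,\ p-\mathbb{E}[c(v)|t_b,t_s])$; payoffs are ex ante expected payoffs $(\pi_b,\pi_s)$.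 For $Y\subset\mathbb{R}^2$, a set $A\subset Y$ is an $\varepsilon$-net of $Y$ if every $y\in Y$ has some $a\in A$ with Euclidean distance $\|y-a\|<\varepsilon$. *)

theory Defs
  imports "HOL-Probability.Probability"
begin

definition measure_support :: "real measure \<Rightarrow> real set" where
  "measure_support M = {x. \<forall>U. open U \<longrightarrow> x \<in> U \<longrightarrow> emeasure M U > 0}"

text \<open>Expectations over \<open>\<mu>\<close> are taken on \<open>V\<close> (where \<open>\<mu>\<close> is concentrated and \<open>c\<close> lives).\<close>
definition surplus :: "real set \<Rightarrow> real measure \<Rightarrow> (real \<Rightarrow> real) \<Rightarrow> real" where
  "surplus V \<mu> c = (\<integral>v. indicator V v * (v - c v) \<partial>\<mu>)"

definition seller_min :: "real set \<Rightarrow> real measure \<Rightarrow> (real \<Rightarrow> real) \<Rightarrow> real" where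
  "seller_min V \<mu> c = max (Inf V - (\<integral>v. indicator V v * c v \<partial>\<mu>)) 0"

definition environment :: "real set \<Rightarrow> real measure \<Rightarrow> (real \<Rightarrow> real) \<Rightarrow> bool" where
  "environment V \<mu> c \<longleftrightarrow>
     compact V \<and> V \<noteq> {} \<and> Inf V < Sup V \<and>
     prob_space \<mu> \<and> sets \<mu> = sets borel \<and> measure_support \<mu> = V \<and>
     continuous_on V c \<and> (\<forall>v\<in>V. v - c v \<ge> 0) \<and> surplus V \<mu> c > 0"

definition price_grid :: "real \<Rightarrow> real set \<Rightarrow> real set \<Rightarrow> bool" where
  "price_grid \<Delta> V G \<longleftrightarrow>
     finite G \<and> G \<noteq> {} \<and> Min G \<le> Inf V \<and> Max G \<ge> Sup V \<and>
     (\<forall>p\<in>G. \<forall>p'\<in>G. p < p' \<and> \<not> (\<exists>r\<in>G. p < r \<and> r < p') \<longrightarrow> p' - p \<le> \<Delta>)"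

definition info_structure ::
  "real measure \<Rightarrow> nat set \<Rightarrow> nat set \<Rightarrow> ((nat \<times> nat) \<times> real) measure \<Rightarrow> bool" where
  "info_structure \<mu> Ts Tb P \<longleftrightarrow>
     finite Ts \<and> finite Tb \<and> prob_space P \<and>
     sets P = sets (count_space (UNIV :: (nat \<times> nat) set) \<Otimes>\<^sub>M (borel :: real measure)) \<and>
     emeasure P ((Ts \<times> Tb) \<times> UNIV) = 1 \<and>
     distr P borel snd = \<mu>"

definition sig_prob :: "((nat \<times> nat) \<times> real) measure \<Rightarrow> nat \<Rightarrow> nat \<Rightarrow> real" where
  "sig_prob P ts tb = measure P ({(ts, tb)} \<times> UNIV)"

definition cond_exp ::
  "real set \<Rightarrow> ((nat \<times> nat) \<times> real) measure \<Rightarrow> (real \<Rightarrow> real) \<Rightarrow> nat \<Rightarrow> nat \<Rightarrow> real" where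
  "cond_exp V P f ts tb =
     (\<integral>x. indicator ({(ts, tb)} \<times> V) x * f (snd x) \<partial>P) / sig_prob P ts tb"

text \<open>Seller behaviour strategy: \<open>\<sigma> ts p\<close> = probability of posting price \<open>p\<close> after
  signal \<open>ts\<close>. Buyer behaviour strategy: \<open>\<beta> tb p\<close> = probability of accepting
  price \<open>p\<close> after signal \<open>tb\<close>. Buyer belief: \<open>\<psi> tb p ts\<close> = probability assigned to
  the node with seller signal \<open>ts\<close> in the information set \<open>(tb,p)\<close>.\<close>

definition seller_strategy :: "nat set \<Rightarrow> real set \<Rightarrow> (nat \<Rightarrow> real \<Rightarrow> real) \<Rightarrow> bool" where
  "seller_strategy Ts G \<sigma> \<longleftrightarrow> (\<forall>ts\<in>Ts. (\<forall>p\<in>G. \<sigma> ts p \<ge> 0) \<and> (\<Sum>p\<in>G. \<sigma> ts p) = 1)"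

definition fully_mixed_seller :: "nat set \<Rightarrow> real set \<Rightarrow> (nat \<Rightarrow> real \<Rightarrow> real) \<Rightarrow> bool" where
  "fully_mixed_seller Ts G \<sigma> \<longleftrightarrow> (\<forall>ts\<in>Ts. (\<forall>p\<in>G. \<sigma> ts p > 0) \<and> (\<Sum>p\<in>G. \<sigma> ts p) = 1)"

definition buyer_strategy :: "nat set \<Rightarrow> real set \<Rightarrow> (nat \<Rightarrow> real \<Rightarrow> real) \<Rightarrow> bool" where
  "buyer_strategy Tb G \<beta> \<longleftrightarrow> (\<forall>tb\<in>Tb. \<forall>p\<in>G. 0 \<le> \<beta> tb p \<and> \<beta> tb p \<le> 1)"

definition fully_mixed_buyer :: "nat set \<Rightarrow> real set \<Rightarrow> (nat \<Rightarrow> real \<Rightarrow> real) \<Rightarrow> bool" where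
  "fully_mixed_buyer Tb G \<beta> \<longleftrightarrow> (\<forall>tb\<in>Tb. \<forall>p\<in>G. 0 < \<beta> tb p \<and> \<beta> tb p < 1)"

definition seller_sig_prob :: "((nat \<times> nat) \<times> real) measure \<Rightarrow> nat set \<Rightarrow> nat \<Rightarrow> real" where
  "seller_sig_prob P Tb ts = (\<Sum>tb\<in>Tb. sig_prob P ts tb)"

definition buyer_sig_prob :: "((nat \<times> nat) \<times> real) measure \<Rightarrow> nat set \<Rightarrow> nat \<Rightarrow> real" where
  "buyer_sig_prob P Ts tb = (\<Sum>ts\<in>Ts. sig_prob P ts tb)"

definition bayes_belief ::
  "((nat \<times> nat) \<times> real) measure \<Rightarrow> nat set \<Rightarrow> (nat \<Rightarrow> real \<Rightarrow> real) \<Rightarrow> nat \<Rightarrow> real \<Rightarrow> nat \<Rightarrow> real" where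
  "bayes_belief P Ts \<sigma> tb p ts =
     sig_prob P ts tb * \<sigma> ts p / (\<Sum>ts'\<in>Ts. sig_prob P ts' tb * \<sigma> ts' p)"

text \<open>Kreps--Wilson consistency (seller beliefs are fixed by Nature and
  automatically consistent; only buyer beliefs need to be checked).\<close>
definition consistent ::
  "((nat \<times> nat) \<times> real) measure \<Rightarrow> nat set \<Rightarrow> nat set \<Rightarrow> real set \<Rightarrow>
   (nat \<Rightarrow> real \<Rightarrow> real) \<Rightarrow> (nat \<Rightarrow> real \<Rightarrow> real) \<Rightarrow> (nat \<Rightarrow> real \<Rightarrow> nat \<Rightarrow> real) \<Rightarrow> bool" where
  "consistent P Ts Tb G \<sigma> \<beta> \<psi> \<longleftrightarrow>
     (\<exists>\<sigma>n \<beta>n :: nat \<Rightarrow> nat \<Rightarrow> real \<Rightarrow> real.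
        (\<forall>k. fully_mixed_seller Ts G (\<sigma>n k) \<and> fully_mixed_buyer Tb G (\<beta>n k)) \<and>
        (\<forall>ts\<in>Ts. \<forall>p\<in>G. (\<lambda>k. \<sigma>n k ts p) \<longlonglongrightarrow> \<sigma> ts p) \<and>
        (\<forall>tb\<in>Tb. \<forall>p\<in>G. (\<lambda>k. \<beta>n k tb p) \<longlonglongrightarrow> \<beta> tb p) \<and>
        (\<forall>tb\<in>Tb. buyer_sig_prob P Ts tb > 0 \<longrightarrow> (\<forall>p\<in>G. \<forall>ts\<in>Ts.
            (\<lambda>k. bayes_belief P Ts (\<sigma>n k) tb p ts) \<longlonglongrightarrow> \<psi> tb p ts)))"

definition seller_value ::
  "real set \<Rightarrow> (real \<Rightarrow> real) \<Rightarrow> ((nat \<times> nat) \<times> real) measure \<Rightarrow> nat set \<Rightarrow>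
   (nat \<Rightarrow> real \<Rightarrow> real) \<Rightarrow> nat \<Rightarrow> real \<Rightarrow> real" where
  "seller_value V c P Tb \<beta> ts p =
     (\<Sum>tb\<in>Tb. (sig_prob P ts tb / seller_sig_prob P Tb ts) * \<beta> tb p * (p - cond_exp V P c ts tb))"

definition buyer_value ::
  "real set \<Rightarrow> ((nat \<times> nat) \<times> real) measure \<Rightarrow> nat set \<Rightarrow>
   (nat \<Rightarrow> real \<Rightarrow> nat \<Rightarrow> real) \<Rightarrow> nat \<Rightarrow> real \<Rightarrow> real" where
  "buyer_value V P Ts \<psi> tb p = (\<Sum>ts\<in>Ts. \<psi> tb p ts * (cond_exp V P (\<lambda>v. v) ts tb - p))"

definition sequentially_rational ::
  "real set \<Rightarrow> (real \<Rightarrow> real) \<Rightarrow> ((nat \<times> nat) \<times> real) measure \<Rightarrow> nat set \<Rightarrow> nat set \<Rightarrow> real set \<Rightarrow>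
   (nat \<Rightarrow> real \<Rightarrow> real) \<Rightarrow> (nat \<Rightarrow> real \<Rightarrow> real) \<Rightarrow> (nat \<Rightarrow> real \<Rightarrow> nat \<Rightarrow> real) \<Rightarrow> bool" where
  "sequentially_rational V c P Ts Tb G \<sigma> \<beta> \<psi> \<longleftrightarrow>
     (\<forall>ts\<in>Ts. seller_sig_prob P Tb ts > 0 \<longrightarrow>
        (\<forall>\<tau> :: real \<Rightarrow> real. (\<forall>p\<in>G. \<tau> p \<ge> 0) \<and> (\<Sum>p\<in>G. \<tau> p) = 1 \<longrightarrow>
           (\<Sum>p\<in>G. \<tau> p * seller_value V c P Tb \<beta> ts p)
             \<le> (\<Sum>p\<in>G. \<sigma> ts p * seller_value V c P Tb \<beta> ts p))) \<and>
     (\<forall>tb\<in>Tb. buyer_sig_prob P Ts tb > 0 \<longrightarrow>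
        (\<forall>p\<in>G. \<forall>b::real. 0 \<le> b \<and> b \<le> 1 \<longrightarrow>
           b * buyer_value V P Ts \<psi> tb p \<le> \<beta> tb p * buyer_value V P Ts \<psi> tb p))"

definition sequential_equilibrium ::
  "real set \<Rightarrow> (real \<Rightarrow> real) \<Rightarrow> ((nat \<times> nat) \<times> real) measure \<Rightarrow> nat set \<Rightarrow> nat set \<Rightarrow> real set \<Rightarrow>
   (nat \<Rightarrow> real \<Rightarrow> real) \<Rightarrow> (nat \<Rightarrow> real \<Rightarrow> real) \<Rightarrow> (nat \<Rightarrow> real \<Rightarrow> nat \<Rightarrow> real) \<Rightarrow> bool" where
  "sequential_equilibrium V c P Ts Tb G \<sigma> \<beta> \<psi> \<longleftrightarrow>
     seller_strategy Ts G \<sigma> \<and> buyer_strategy Tb G \<beta> \<and>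
     consistent P Ts Tb G \<sigma> \<beta> \<psi> \<and>
     sequentially_rational V c P Ts Tb G \<sigma> \<beta> \<psi>"

definition buyer_payoff ::
  "real set \<Rightarrow> ((nat \<times> nat) \<times> real) measure \<Rightarrow> nat set \<Rightarrow> nat set \<Rightarrow> real set \<Rightarrow>
   (nat \<Rightarrow> real \<Rightarrow> real) \<Rightarrow> (nat \<Rightarrow> real \<Rightarrow> real) \<Rightarrow> real" where
  "buyer_payoff V P Ts Tb G \<sigma> \<beta> =
     (\<Sum>ts\<in>Ts. \<Sum>tb\<in>Tb. sig_prob P ts tb *
        (\<Sum>p\<in>G. \<sigma> ts p * \<beta> tb p * (cond_exp V P (\<lambda>v. v) ts tb - p)))"

definition seller_payoff ::
  "real set \<Rightarrow> (real \<Rightarrow> real) \<Rightarrow> ((nat \<times> nat) \<times> real) measure \<Rightarrow> nat set \<Rightarrow> nat set \<Rightarrow> real set \<Rightarrow>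
   (nat \<Rightarrow> real \<Rightarrow> real) \<Rightarrow> (nat \<Rightarrow> real \<Rightarrow> real) \<Rightarrow> real" where
  "seller_payoff V c P Ts Tb G \<sigma> \<beta> =
     (\<Sum>ts\<in>Ts. \<Sum>tb\<in>Tb. sig_prob P ts tb *
        (\<Sum>p\<in>G. \<sigma> ts p * \<beta> tb p * (p - cond_exp V P c ts tb)))"

definition SE_payoffs ::
  "real set \<Rightarrow> (real \<Rightarrow> real) \<Rightarrow> ((nat \<times> nat) \<times> real) measure \<Rightarrow> nat set \<Rightarrow> nat set \<Rightarrow> real set \<Rightarrow>
   (real \<times> real) set" where
  "SE_payoffs V c P Ts Tb G =
     {(buyer_payoff V P Ts Tb G \<sigma> \<beta>, seller_payoff V c P Ts Tb G \<sigma> \<beta>) | \<sigma> \<beta> \<psi>.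
        sequential_equilibrium V c P Ts Tb G \<sigma> \<beta> \<psi>}"

definition eps_net :: "(real \<times> real) set \<Rightarrow> (real \<times> real) set \<Rightarrow> real \<Rightarrow> bool" where
  "eps_net A Y \<epsilon> \<longleftrightarrow> A \<subseteq> Y \<and> (\<forall>y\<in>Y. \<exists>a\<in>A. dist y a < \<epsilon>)"

end

theory Submission
  imports Defs
begin


text \<open>
  Four signal pairs \<open>(0,0), (1,0), (1,1), (2,1)\<close>, written as (seller, buyer), carry positive
  probability. The first and third have tiny mass and mean value \<open>w\<close> just above \<open>Inf V\<close>, the
  second has small mass and the prior mean, and the last, which carries almost all the mass, has
  mean value equal to a price \<open>p2\<close> slightly above the prior mean \<open>Ev\<close>. If low seller types tremble
  much more often than high ones, each buyer type attributes every unexpected price to the seller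
  type at which the value is only \<open>w\<close>, so every such price above \<open>w\<close> is rejected. Hence any price
  \<open>p1\<close> between \<open>max (Inf V) Ec\<close> and \<open>Ev\<close> can be sustained, where \<open>Ec\<close> is the mean cost, and the
  seller's payoff is \<open>p1 - Ec\<close>. Moreover seller type \<open>2\<close> can be made indifferent between \<open>p1\<close> and
  \<open>p2\<close>; at \<open>p2\<close> the buyer earns nothing, so the mixing probability moves the buyer's payoff between
  about \<open>0\<close> and \<open>Ev - p1\<close>. Conversely, in every equilibrium the seller can secure
  \<open>Inf V - Ec\<close> by a price between \<open>Inf V\<close> and \<open>w\<close>, which is accepted under any belief.
\<close>

section \<open>Bounds on equilibrium payoffs\<close>

text \<open>Against a fully mixed seller the Bayes denominator is positive, so the approximating
  beliefs are probability vectors without mass on impossible pairs, and this survives in the limit.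
  The first three facts therefore bind at unexpected prices as well. The last needs a positive
  denominator in the limit, where Bayes' rule is continuous.\<close>

lemma consistent_beliefs:
  assumes fin: "finite Ts" and tb: "tb \<in> Tb" and p: "p \<in> G"
    and pos: "buyer_sig_prob P Ts tb > 0"
    and cons: "consistent P Ts Tb G \<sigma> \<beta> \<psi>"
  shows consistent_belief_nonneg: "ts \<in> Ts \<Longrightarrow> \<psi> tb p ts \<ge> 0"
    and consistent_belief_sum: "(\<Sum>ts\<in>Ts. \<psi> tb p ts) = 1"
    and consistent_belief_null: "ts \<in> Ts \<Longrightarrow> sig_prob P ts tb = 0 \<Longrightarrow> \<psi> tb p ts = 0"
    and consistent_belief_bayes: "ts \<in> Ts \<Longrightarrow> (\<Sum>ts'\<in>Ts. sig_prob P ts' tb * \<sigma> ts' p) \<noteq> 0 \<Longrightarrow>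
          \<psi> tb p ts = bayes_belief P Ts \<sigma> tb p ts"
proof -
  obtain \<sigma>n \<beta>n :: "nat \<Rightarrow> nat \<Rightarrow> real \<Rightarrow> real" where
    fm: "\<And>k. fully_mixed_seller Ts G (\<sigma>n k)" and
    lim: "\<And>ts. ts \<in> Ts \<Longrightarrow> (\<lambda>k. \<sigma>n k ts p) \<longlonglongrightarrow> \<sigma> ts p" and
    bel: "\<And>ts. ts \<in> Ts \<Longrightarrow> (\<lambda>k. bayes_belief P Ts (\<sigma>n k) tb p ts) \<longlonglongrightarrow> \<psi> tb p ts"
    using cons tb p pos unfolding consistent_def by blast
  have s0: "sig_prob P ts tb \<ge> 0" for ts by (simp add: sig_prob_def)
  have sn: "\<sigma>n k ts p > 0" if "ts \<in> Ts" for k ts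
    using fm[of k] that p unfolding fully_mixed_seller_def by blast
  obtain t0 where t0: "t0 \<in> Ts" "sig_prob P t0 tb > 0"
    using pos s0 unfolding buyer_sig_prob_def by (metis less_eq_real_def sum_nonpos not_less)
  have den: "(\<Sum>ts'\<in>Ts. sig_prob P ts' tb * \<sigma>n k ts' p) > 0" for k
    by (rule sum_pos2[OF fin t0(1)]) (use t0 s0 sn in \<open>auto intro!: mult_pos_pos mult_nonneg_nonneg simp: less_imp_le\<close>)
  have bn: "bayes_belief P Ts (\<sigma>n k) tb p ts \<ge> 0" if "ts \<in> Ts" for k ts
    unfolding bayes_belief_def
    by (intro divide_nonneg_pos den mult_nonneg_nonneg s0 less_imp_le[OF sn[OF that]])
  show "\<psi> tb p ts \<ge> 0" if "ts \<in> Ts"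
    by (rule LIMSEQ_le_const[OF bel[OF that]]) (use bn that in blast)
  have "(\<Sum>ts\<in>Ts. bayes_belief P Ts (\<sigma>n k) tb p ts) = 1" for k
    using den[of k] by (simp add: bayes_belief_def flip: sum_divide_distrib)
  moreover have "(\<lambda>k. \<Sum>ts\<in>Ts. bayes_belief P Ts (\<sigma>n k) tb p ts) \<longlonglongrightarrow> (\<Sum>ts\<in>Ts. \<psi> tb p ts)"
    by (rule tendsto_sum) (rule bel)
  ultimately show "(\<Sum>ts\<in>Ts. \<psi> tb p ts) = 1"
    by (simp add: LIMSEQ_const_iff)
  show "\<psi> tb p ts = 0" if "ts \<in> Ts" "sig_prob P ts tb = 0"
    using bel[OF that(1)] that(2) by (simp add: bayes_belief_def LIMSEQ_const_iff)
  show "\<psi> tb p ts = bayes_belief P Ts \<sigma> tb p ts"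
    if "ts \<in> Ts" "(\<Sum>ts'\<in>Ts. sig_prob P ts' tb * \<sigma> ts' p) \<noteq> 0"
  proof (rule LIMSEQ_unique[OF bel[OF that(1)]])
    show "(\<lambda>k. bayes_belief P Ts (\<sigma>n k) tb p ts) \<longlonglongrightarrow> bayes_belief P Ts \<sigma> tb p ts"
      unfolding bayes_belief_def using that by (intro tendsto_intros lim) auto
  qed
qed

lemma sequentially_rational_buyer:
  assumes "sequentially_rational V c P Ts Tb G \<sigma> \<beta> \<psi>" "tb \<in> Tb" "p \<in> G"
    and "buyer_sig_prob P Ts tb > 0" "0 \<le> b" "b \<le> 1"
  shows "b * buyer_value V P Ts \<psi> tb p \<le> \<beta> tb p * buyer_value V P Ts \<psi> tb p"
  using assms unfolding sequentially_rational_def by blast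

text \<open>The payoff is grouped by the buyer's information sets \<open>(tb, p)\<close>. A reached
  set carries the Bayes belief, so its term is reach probability times acceptance times
  \<open>buyer_value\<close>, and rejection would give 0. An unreached set contributes
  nothing.\<close>

lemma buyer_payoff_nonneg:
  assumes fin: "finite Ts"
    and se: "sequential_equilibrium V c P Ts Tb G \<sigma> \<beta> \<psi>"
  shows "buyer_payoff V P Ts Tb G \<sigma> \<beta> \<ge> 0"
proof -
  have s0: "sig_prob P ts tb \<ge> 0" for ts tb by (simp add: sig_prob_def)
  have \<sigma>0: "\<sigma> ts p \<ge> 0" if "ts \<in> Ts" "p \<in> G" for ts p
    using se that unfolding sequential_equilibrium_def seller_strategy_def by blast
  have cons: "consistent P Ts Tb G \<sigma> \<beta> \<psi>"
    and sr: "sequentially_rational V c P Ts Tb G \<sigma> \<beta> \<psi>"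
    using se unfolding sequential_equilibrium_def by auto
  have "0 \<le> \<beta> tb p * (\<Sum>ts\<in>Ts. sig_prob P ts tb * \<sigma> ts p * (cond_exp V P (\<lambda>v. v) ts tb - p))"
    if tb: "tb \<in> Tb" and p: "p \<in> G" for tb p
  proof -
    \<comment> \<open>\<open>W\<close> is the probability that the information set is
      reached.\<close>
    define W where "W = (\<Sum>ts\<in>Ts. sig_prob P ts tb * \<sigma> ts p)"
    have t0: "sig_prob P ts tb * \<sigma> ts p \<ge> 0" if "ts \<in> Ts" for ts
      using s0 \<sigma>0[OF that p] by simp
    show ?thesis
    proof (cases "W = 0")
      case True
      then have "sig_prob P ts tb * \<sigma> ts p = 0" if "ts \<in> Ts" for ts
        using t0 that sum_nonneg_eq_0_iff[OF fin, of "\<lambda>ts. sig_prob P ts tb * \<sigma> ts p"]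
        unfolding W_def by blast
      then have "(\<Sum>ts\<in>Ts. sig_prob P ts tb * \<sigma> ts p * (cond_exp V P (\<lambda>v. v) ts tb - p)) = 0"
        by (intro sum.neutral ballI) (metis mult_zero_left)
      then show ?thesis by simp
    next
      case False
      moreover have "W \<ge> 0" unfolding W_def by (intro sum_nonneg t0)
      ultimately have W: "W > 0" by simp
      have B: "buyer_sig_prob P Ts tb > 0"
      proof (rule ccontr)
        assume "\<not> ?thesis"
        moreover have "buyer_sig_prob P Ts tb \<ge> 0"
          unfolding buyer_sig_prob_def by (intro sum_nonneg s0)
        ultimately have "buyer_sig_prob P Ts tb = 0" by simp
        then have "\<forall>ts\<in>Ts. sig_prob P ts tb = 0"
          using s0 fin by (simp add: buyer_sig_prob_def sum_nonneg_eq_0_iff)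
        then show False using False by (simp add: W_def)
      qed
      have "(\<Sum>ts\<in>Ts. sig_prob P ts tb * \<sigma> ts p * (cond_exp V P (\<lambda>v. v) ts tb - p))
            = W * buyer_value V P Ts \<psi> tb p"
        unfolding buyer_value_def sum_distrib_left
      proof (rule sum.cong[OF refl])
        fix ts assume ts: "ts \<in> Ts"
        have "\<psi> tb p ts = sig_prob P ts tb * \<sigma> ts p / W"
          using consistent_belief_bayes[OF fin tb p B cons ts] False
          by (simp add: W_def bayes_belief_def)
        then show "sig_prob P ts tb * \<sigma> ts p * (cond_exp V P (\<lambda>v. v) ts tb - p)
            = W * (\<psi> tb p ts * (cond_exp V P (\<lambda>v. v) ts tb - p))"
          using False by simp
      qed
      moreover have "0 * buyer_value V P Ts \<psi> tb p \<le> \<beta> tb p * buyer_value V P Ts \<psi> tb p"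
        by (rule sequentially_rational_buyer[OF sr tb p B]) auto
      ultimately show ?thesis using W by (simp add: mult.left_commute)
    qed
  qed
  then have "0 \<le> (\<Sum>tb\<in>Tb. \<Sum>p\<in>G. \<beta> tb p * (\<Sum>ts\<in>Ts. sig_prob P ts tb * \<sigma> ts p * (cond_exp V P (\<lambda>v. v) ts tb - p)))"
    by (intro sum_nonneg)
  also have "\<dots> = (\<Sum>tb\<in>Tb. \<Sum>p\<in>G. \<Sum>ts\<in>Ts. sig_prob P ts tb * (\<sigma> ts p * \<beta> tb p * (cond_exp V P (\<lambda>v. v) ts tb - p)))"
    by (simp add: sum_distrib_left mult_ac)
  also have "\<dots> = (\<Sum>tb\<in>Tb. \<Sum>ts\<in>Ts. \<Sum>p\<in>G. sig_prob P ts tb * (\<sigma> ts p * \<beta> tb p * (cond_exp V P (\<lambda>v. v) ts tb - p)))"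
    by (rule sum.cong[OF refl]) (rule sum.swap)
  also have "\<dots> = buyer_payoff V P Ts Tb G \<sigma> \<beta>"
    unfolding buyer_payoff_def by (subst sum.swap) (simp add: sum_distrib_left)
  finally show ?thesis .
qed

text \<open>Each seller type of positive probability weakly prefers its strategy to posting
  \<open>p\<close> for sure. These comparisons are weighted by the type probabilities and added; a
  null type adds 0 to both sides.\<close>

lemma seller_payoff_ge_deviation:
  assumes fin: "finite Ts" "finite Tb" "finite G" and p: "p \<in> G"
    and se: "sequential_equilibrium V c P Ts Tb G \<sigma> \<beta> \<psi>"
  shows "(\<Sum>ts\<in>Ts. \<Sum>tb\<in>Tb. sig_prob P ts tb * \<beta> tb p * (p - cond_exp V P c ts tb))
         \<le> seller_payoff V c P Ts Tb G \<sigma> \<beta>"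
  unfolding seller_payoff_def
proof (rule sum_mono)
  fix ts assume ts: "ts \<in> Ts"
  have s0: "sig_prob P ts tb \<ge> 0" for ts tb by (simp add: sig_prob_def)
  have sr: "sequentially_rational V c P Ts Tb G \<sigma> \<beta> \<psi>"
    using se unfolding sequential_equilibrium_def by auto
  define S where "S = seller_sig_prob P Tb ts"
  show "(\<Sum>tb\<in>Tb. sig_prob P ts tb * \<beta> tb p * (p - cond_exp V P c ts tb))
    \<le> (\<Sum>tb\<in>Tb. sig_prob P ts tb * (\<Sum>p\<in>G. \<sigma> ts p * \<beta> tb p * (p - cond_exp V P c ts tb)))"
  proof (cases "S = 0")
    case True
    then have "\<forall>tb\<in>Tb. sig_prob P ts tb = 0"
      using s0 fin by (simp add: S_def seller_sig_prob_def sum_nonneg_eq_0_iff)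
    then show ?thesis by simp
  next
    case False
    then have S: "S > 0"
      using s0 unfolding S_def seller_sig_prob_def by (metis less_eq_real_def sum_nonneg)
    have val: "(\<Sum>tb\<in>Tb. sig_prob P ts tb * \<beta> tb r * (r - cond_exp V P c ts tb))
       = S * seller_value V c P Tb \<beta> ts r" for r
      using S unfolding seller_value_def S_def[symmetric] sum_distrib_left by (intro sum.cong) auto
    define \<tau> :: "real \<Rightarrow> real" where "\<tau> = (\<lambda>r. if r = p then 1 else 0)"
    have "(\<forall>r\<in>G. \<tau> r \<ge> 0) \<and> (\<Sum>r\<in>G. \<tau> r) = 1" using fin p by (simp add: \<tau>_def)
    then have "(\<Sum>r\<in>G. \<tau> r * seller_value V c P Tb \<beta> ts r)
             \<le> (\<Sum>r\<in>G. \<sigma> ts r * seller_value V c P Tb \<beta> ts r)"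
      using sr ts S unfolding sequentially_rational_def S_def by blast
    moreover have "(\<Sum>r\<in>G. \<tau> r * seller_value V c P Tb \<beta> ts r) = seller_value V c P Tb \<beta> ts p"
      using fin p unfolding \<tau>_def by (simp add: if_distrib[of "\<lambda>x. x * _"] cong: if_cong)
    ultimately have "S * seller_value V c P Tb \<beta> ts p \<le> S * (\<Sum>r\<in>G. \<sigma> ts r * seller_value V c P Tb \<beta> ts r)"
      using S by simp
    also have "\<dots> = (\<Sum>r\<in>G. \<sigma> ts r * (S * seller_value V c P Tb \<beta> ts r))"
      by (simp add: sum_distrib_left mult_ac)
    also have "\<dots> = (\<Sum>r\<in>G. \<Sum>tb\<in>Tb. sig_prob P ts tb * (\<sigma> ts r * \<beta> tb r * (r - cond_exp V P c ts tb)))"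
      unfolding val[symmetric] by (simp add: sum_distrib_left mult_ac)
    also have "\<dots> = (\<Sum>tb\<in>Tb. sig_prob P ts tb * (\<Sum>p\<in>G. \<sigma> ts p * \<beta> tb p * (p - cond_exp V P c ts tb)))"
      by (subst sum.swap) (simp add: sum_distrib_left)
    finally show ?thesis unfolding val .
  qed
qed

text \<open>Consistency confines the belief to seller types that can occur together with
  \<open>tb\<close>, whether or not \<open>p\<close> is ever posted. Under any such belief the
  expected gain is positive, so only certain acceptance is optimal.\<close>

lemma buyer_accepts_low_price:
  assumes fin: "finite Ts" and tb: "tb \<in> Tb" and p: "p \<in> G"
    and pos: "buyer_sig_prob P Ts tb > 0"
    and se: "sequential_equilibrium V c P Ts Tb G \<sigma> \<beta> \<psi>"
    and low: "\<And>ts. ts \<in> Ts \<Longrightarrow> sig_prob P ts tb > 0 \<Longrightarrow> p < cond_exp V P (\<lambda>v. v) ts tb"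
  shows "\<beta> tb p = 1"
proof -
  have cons: "consistent P Ts Tb G \<sigma> \<beta> \<psi>"
    and sr: "sequentially_rational V c P Ts Tb G \<sigma> \<beta> \<psi>"
    and bs: "buyer_strategy Tb G \<beta>"
    using se unfolding sequential_equilibrium_def by auto
  note cb = consistent_beliefs[OF fin tb p pos cons]
  have t: "\<psi> tb p ts * (cond_exp V P (\<lambda>v. v) ts tb - p) \<ge> 0" if "ts \<in> Ts" for ts
  proof (cases "sig_prob P ts tb = 0")
    case True then show ?thesis using cb(3) that by simp
  next
    case False
    then have "sig_prob P ts tb > 0" by (simp add: sig_prob_def zero_less_measure_iff)
    then show ?thesis using low[OF that] cb(1)[OF that] by simp
  qed
  obtain t0 where t0: "t0 \<in> Ts" "\<psi> tb p t0 \<noteq> 0"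
    using cb(2) by (metis sum.neutral zero_neq_one)
  then have "\<psi> tb p t0 > 0" "sig_prob P t0 tb > 0"
    using cb(1,3)[OF t0(1)] by (auto simp: less_le sig_prob_def)
  then have "\<psi> tb p t0 * (cond_exp V P (\<lambda>v. v) t0 tb - p) > 0" using low[OF t0(1)] by simp
  then have bv: "buyer_value V P Ts \<psi> tb p > 0"
    unfolding buyer_value_def by (intro sum_pos2[OF fin t0(1)] t)
  have "1 * buyer_value V P Ts \<psi> tb p \<le> \<beta> tb p * buyer_value V P Ts \<psi> tb p"
    by (rule sequentially_rational_buyer[OF sr tb p pos]) auto
  then have "\<beta> tb p \<ge> 1" using bv by (metis mult_le_cancel_right_pos)
  moreover have "\<beta> tb p \<le> 1" using bs tb p unfolding buyer_strategy_def by auto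
  ultimately show ?thesis by simp
qed

text \<open>The price is a transfer and cancels in the sum. What remains at each signal pair is a
  nonnegative gain from trade times a trade probability of at most 1.\<close>

lemma total_payoff_le:
  assumes ss: "seller_strategy Ts G \<sigma>" and bs: "buyer_strategy Tb G \<beta>"
    and gain: "\<And>ts tb. ts \<in> Ts \<Longrightarrow> tb \<in> Tb \<Longrightarrow> sig_prob P ts tb > 0 \<Longrightarrow>
                 cond_exp V P c ts tb \<le> cond_exp V P (\<lambda>v. v) ts tb"
  shows "buyer_payoff V P Ts Tb G \<sigma> \<beta> + seller_payoff V c P Ts Tb G \<sigma> \<beta>
     \<le> (\<Sum>ts\<in>Ts. \<Sum>tb\<in>Tb. sig_prob P ts tb * (cond_exp V P (\<lambda>v. v) ts tb - cond_exp V P c ts tb))"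
  unfolding buyer_payoff_def seller_payoff_def sum.distrib[symmetric]
proof (intro sum_mono)
  fix ts tb assume ts: "ts \<in> Ts" and tb: "tb \<in> Tb"
  let ?v = "cond_exp V P (\<lambda>v. v) ts tb" and ?c = "cond_exp V P c ts tb" and ?s = "sig_prob P ts tb"
  have "(\<Sum>p\<in>G. \<sigma> ts p * \<beta> tb p) \<le> (\<Sum>p\<in>G. \<sigma> ts p)"
    using ss bs ts tb unfolding seller_strategy_def buyer_strategy_def
    by (intro sum_mono) (simp add: mult_left_le)
  also have "\<dots> = 1" using ss ts unfolding seller_strategy_def by blast
  finally have le: "(\<Sum>p\<in>G. \<sigma> ts p * \<beta> tb p) \<le> 1" .
  have "?s * (\<Sum>p\<in>G. \<sigma> ts p * \<beta> tb p * (?v - p)) + ?s * (\<Sum>p\<in>G. \<sigma> ts p * \<beta> tb p * (p - ?c))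
     = (\<Sum>p\<in>G. \<sigma> ts p * \<beta> tb p) * (?s * (?v - ?c))"
    by (simp add: sum_distrib_left sum_distrib_right sum.distrib[symmetric] algebra_simps)
  also have "\<dots> \<le> 1 * (?s * (?v - ?c))"
  proof (rule mult_right_mono[OF le])
    show "0 \<le> ?s * (?v - ?c)"
      using gain[OF ts tb] by (cases "?s = 0") (auto simp: sig_prob_def zero_less_measure_iff)
  qed
  finally show "?s * (\<Sum>p\<in>G. \<sigma> ts p * \<beta> tb p * (?v - p)) + ?s * (\<Sum>p\<in>G. \<sigma> ts p * \<beta> tb p * (p - ?c))
     \<le> ?s * (?v - ?c)" by simp
qed

text \<open>The seller's two lower bounds come from two deviations. At \<open>g\<close>, below every
  conditional value, a sale is certain; at \<open>h\<close>, which no conditional cost exceeds, no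
  sale loses money, whatever the buyer does.\<close>

lemma SE_payoffs_bounds:
  assumes fin: "finite Ts" "finite Tb" "finite G" and g: "g \<in> G" and h: "h \<in> G"
    and y: "(\<pi>b, \<pi>s) \<in> SE_payoffs V c P Ts Tb G"
    and prob: "(\<Sum>ts\<in>Ts. \<Sum>tb\<in>Tb. sig_prob P ts tb) = 1"
    and Ev: "(\<Sum>ts\<in>Ts. \<Sum>tb\<in>Tb. sig_prob P ts tb * cond_exp V P (\<lambda>v. v) ts tb) = Ev"
    and Ec: "(\<Sum>ts\<in>Ts. \<Sum>tb\<in>Tb. sig_prob P ts tb * cond_exp V P c ts tb) = Ec"
    and gain: "\<And>ts tb. ts \<in> Ts \<Longrightarrow> tb \<in> Tb \<Longrightarrow> sig_prob P ts tb > 0 \<Longrightarrow>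
                 cond_exp V P c ts tb \<le> cond_exp V P (\<lambda>v. v) ts tb"
    and low: "\<And>ts tb. ts \<in> Ts \<Longrightarrow> tb \<in> Tb \<Longrightarrow> sig_prob P ts tb > 0 \<Longrightarrow>
                 g < cond_exp V P (\<lambda>v. v) ts tb"
    and high: "\<And>ts tb. ts \<in> Ts \<Longrightarrow> tb \<in> Tb \<Longrightarrow> sig_prob P ts tb > 0 \<Longrightarrow>
                 cond_exp V P c ts tb \<le> h"
  shows "\<pi>b \<ge> 0" and "\<pi>s \<ge> 0" and "\<pi>s \<ge> g - Ec" and "\<pi>b + \<pi>s \<le> Ev - Ec"
proof -
  obtain \<sigma> \<beta> \<psi> where pb: "\<pi>b = buyer_payoff V P Ts Tb G \<sigma> \<beta>"
    and ps: "\<pi>s = seller_payoff V c P Ts Tb G \<sigma> \<beta>"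
    and se: "sequential_equilibrium V c P Ts Tb G \<sigma> \<beta> \<psi>"
    using y unfolding SE_payoffs_def by auto
  have ss: "seller_strategy Ts G \<sigma>" and bs: "buyer_strategy Tb G \<beta>"
    using se unfolding sequential_equilibrium_def by auto
  have s0: "sig_prob P ts tb \<ge> 0" for ts tb by (simp add: sig_prob_def)
  show "\<pi>b \<ge> 0" unfolding pb by (rule buyer_payoff_nonneg[OF fin(1) se])
  have "0 \<le> (\<Sum>ts\<in>Ts. \<Sum>tb\<in>Tb. sig_prob P ts tb * \<beta> tb h * (h - cond_exp V P c ts tb))"
  proof (intro sum_nonneg)
    fix ts tb assume ts: "ts \<in> Ts" and tb: "tb \<in> Tb"
    have "\<beta> tb h \<ge> 0" using bs tb h unfolding buyer_strategy_def by auto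
    then show "0 \<le> sig_prob P ts tb * \<beta> tb h * (h - cond_exp V P c ts tb)"
      using high[OF ts tb] s0[of ts tb] by (cases "sig_prob P ts tb = 0") auto
  qed
  then show "\<pi>s \<ge> 0" using seller_payoff_ge_deviation[OF fin h se] unfolding ps by simp
  have "(\<Sum>ts\<in>Ts. \<Sum>tb\<in>Tb. sig_prob P ts tb * \<beta> tb g * (g - cond_exp V P c ts tb))
     = (\<Sum>ts\<in>Ts. \<Sum>tb\<in>Tb. g * sig_prob P ts tb - sig_prob P ts tb * cond_exp V P c ts tb)"
  proof (intro sum.cong refl)
    fix ts tb assume ts: "ts \<in> Ts" and tb: "tb \<in> Tb"
    show "sig_prob P ts tb * \<beta> tb g * (g - cond_exp V P c ts tb)
      = g * sig_prob P ts tb - sig_prob P ts tb * cond_exp V P c ts tb"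
    proof (cases "sig_prob P ts tb = 0")
      case False
      then have "buyer_sig_prob P Ts tb > 0"
        unfolding buyer_sig_prob_def using s0 ts by (intro sum_pos2[OF fin(1) ts]) (auto simp: less_le)
      then have "\<beta> tb g = 1"
        using buyer_accepts_low_price[OF fin(1) tb g _ se] low tb by blast
      then show ?thesis by (simp add: algebra_simps)
    qed simp
  qed
  also have "\<dots> = g - Ec"
    by (simp add: sum_subtractf Ec prob flip: sum_distrib_left)
  finally show "\<pi>s \<ge> g - Ec" using seller_payoff_ge_deviation[OF fin g se] unfolding ps by simp
  have "\<pi>b + \<pi>s \<le> (\<Sum>ts\<in>Ts. \<Sum>tb\<in>Tb. sig_prob P ts tb * (cond_exp V P (\<lambda>v. v) ts tb - cond_exp V P c ts tb))"
    unfolding pb ps by (rule total_payoff_le[OF ss bs gain])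
  also have "\<dots> = Ev - Ec"
    by (simp add: right_diff_distrib sum_subtractf Ev Ec)
  finally show "\<pi>b + \<pi>s \<le> Ev - Ec" .
qed


section \<open>Information structures given by densities\<close>

text \<open>\<open>f k v\<close> is meant as the conditional probability of the signal pair
  \<open>k\<close> given the value \<open>v\<close>; once these sum to 1 over \<open>k\<close>, the
  second marginal is \<open>\<mu>\<close>.\<close>

definition signal_density :: "real measure \<Rightarrow> (nat \<times> nat \<Rightarrow> real \<Rightarrow> real) \<Rightarrow> ((nat \<times> nat) \<times> real) measure" where
  "signal_density \<mu> f = density (count_space UNIV \<Otimes>\<^sub>M \<mu>) (\<lambda>(k, v). ennreal (f k v))"

lemma sets_signal_density:
  assumes "sets \<mu> = sets borel"
  shows "sets (signal_density \<mu> f) = sets (count_space UNIV \<Otimes>\<^sub>M borel)"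
  unfolding signal_density_def sets_density by (rule sets_pair_measure_cong[OF refl assms])

lemma emeasure_signal_density:
  assumes \<mu>: "prob_space \<mu>" "sets \<mu> = sets borel"
    and f: "\<And>k. f k \<in> borel_measurable borel"
    and A: "A \<in> sets (count_space UNIV \<Otimes>\<^sub>M borel)"
  shows "emeasure (signal_density \<mu> f) A = (\<integral>\<^sup>+k. (\<integral>\<^sup>+v. ennreal (f k v) * indicator A (k, v) \<partial>\<mu>) \<partial>count_space UNIV)"
proof -
  interpret prob_space \<mu> by fact
  have s: "sets (count_space UNIV \<Otimes>\<^sub>M \<mu>) = sets (count_space (UNIV :: (nat\<times>nat) set) \<Otimes>\<^sub>M borel)"
    by (rule sets_pair_measure_cong[OF refl \<mu>(2)])
  have [measurable]: "f k \<in> borel_measurable \<mu>" for k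
    using f by (simp add: measurable_cong_sets[OF \<mu>(2) refl])
  have m: "(\<lambda>(k, v). ennreal (f k v)) \<in> borel_measurable (count_space UNIV \<Otimes>\<^sub>M \<mu>)"
    by (rule measurable_pair_measure_countable1) auto
  have A': "A \<in> sets (count_space UNIV \<Otimes>\<^sub>M \<mu>)" using A s by simp
  have mm: "(\<lambda>x. (case x of (k, v) \<Rightarrow> ennreal (f k v)) * indicator A x) \<in> borel_measurable (count_space UNIV \<Otimes>\<^sub>M \<mu>)"
    using m A' by measurable
  show ?thesis
    unfolding signal_density_def emeasure_density[OF m A']
    by (subst nn_integral_fst[OF mm, symmetric]) simp
qed

context
  fixes \<mu> :: "real measure" and f :: "nat \<times> nat \<Rightarrow> real \<Rightarrow> real" and Ts Tb :: "nat set"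
  assumes \<mu>: "prob_space \<mu>" "sets \<mu> = sets borel"
    and f: "\<And>k. f k \<in> borel_measurable borel"
    and nonneg: "\<And>k v. f k v \<ge> 0"
    and finite: "finite Ts" "finite Tb"
    and null: "\<And>k v. k \<notin> Ts \<times> Tb \<Longrightarrow> f k v = 0"
    and total: "\<And>v. (\<Sum>k\<in>Ts \<times> Tb. f k v) = 1"
begin

text \<open>Exchanging the finite sum over signals with the integral leaves weight 1 at each
  \<open>v\<close>. \<open>B = UNIV\<close> gives the total mass, a general \<open>B\<close> the
  marginal.\<close>

lemma nn_integral_signal_sum:
  assumes B: "B \<in> sets borel"
  shows "(\<integral>\<^sup>+k. (\<integral>\<^sup>+v. ennreal (f k v) * indicator B v \<partial>\<mu>) \<partial>count_space UNIV) = emeasure \<mu> B"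
proof -
  have [measurable]: "f k \<in> borel_measurable \<mu>" for k
    using f by (simp add: measurable_cong_sets[OF \<mu>(2) refl])
  have [measurable]: "B \<in> sets \<mu>" using B \<mu> by simp
  have "(\<integral>\<^sup>+k. (\<integral>\<^sup>+v. ennreal (f k v) * indicator B v \<partial>\<mu>) \<partial>count_space UNIV)
     = (\<Sum>k\<in>Ts \<times> Tb. (\<integral>\<^sup>+v. ennreal (f k v) * indicator B v \<partial>\<mu>))"
    by (rule nn_integral_count_space') (use finite null in auto)
  also have "\<dots> = (\<integral>\<^sup>+v. (\<Sum>k\<in>Ts \<times> Tb. ennreal (f k v) * indicator B v) \<partial>\<mu>)"
    by (rule nn_integral_sum[symmetric]) measurable
  also have "\<dots> = (\<integral>\<^sup>+v. indicator B v \<partial>\<mu>)"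
  proof (rule nn_integral_cong)
    fix v
    show "(\<Sum>k\<in>Ts \<times> Tb. ennreal (f k v) * indicator B v) = indicator B v"
      by (simp add: sum_distrib_right[symmetric] sum_ennreal nonneg total)
  qed
  also have "\<dots> = emeasure \<mu> B" by simp
  finally show ?thesis .
qed

lemma info_structure_signal_density: "info_structure \<mu> Ts Tb (signal_density \<mu> f)"
proof -
  interpret prob_space \<mu> by (fact \<mu>(1))
  note em = emeasure_signal_density[OF \<mu> f]
  have sp: "space (signal_density \<mu> f) = UNIV"
    using sets_eq_imp_space_eq[OF sets_signal_density[OF \<mu>(2)], of f] by (simp add: space_pair_measure)
  have UU: "UNIV \<in> sets (count_space (UNIV :: (nat\<times>nat) set) \<Otimes>\<^sub>M (borel :: real measure))"
    by (metis UNIV_Times_UNIV pair_measureI sets.top space_borel space_count_space)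
  have one: "emeasure \<mu> UNIV = 1"
    using emeasure_space_1 sets_eq_imp_space_eq[OF \<mu>(2)] by simp
  have "emeasure (signal_density \<mu> f) UNIV = 1"
    using em[OF UU] nn_integral_signal_sum[of UNIV] one by simp
  then have ps: "prob_space (signal_density \<mu> f)"
    by (intro prob_spaceI) (simp add: sp)
  have TT: "(Ts \<times> Tb) \<times> UNIV \<in> sets (count_space (UNIV :: (nat\<times>nat) set) \<Otimes>\<^sub>M (borel :: real measure))"
    by (intro pair_measureI) auto
  have "emeasure (signal_density \<mu> f) ((Ts \<times> Tb) \<times> UNIV) = 1"
  proof -
    have "(\<integral>\<^sup>+v. ennreal (f k v) * indicator ((Ts \<times> Tb) \<times> UNIV) (k, v) \<partial>\<mu>) = (\<integral>\<^sup>+v. ennreal (f k v) * indicator UNIV v \<partial>\<mu>)" for k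
      using null[of k] by (intro nn_integral_cong) (cases "k \<in> Ts \<times> Tb", auto simp: indicator_def)
    then show ?thesis unfolding em[OF TT] using nn_integral_signal_sum[of UNIV] one by simp
  qed
  moreover have "distr (signal_density \<mu> f) borel snd = \<mu>"
  proof (rule measure_eqI)
    have ms: "snd \<in> signal_density \<mu> f \<rightarrow>\<^sub>M borel"
      using measurable_cong_sets[OF sets_signal_density[OF \<mu>(2)] refl, of f] by auto
    fix B assume "B \<in> sets (distr (signal_density \<mu> f) borel snd)"
    then have B: "B \<in> sets borel" by simp
    have UB: "UNIV \<times> B \<in> sets (count_space (UNIV :: (nat\<times>nat) set) \<Otimes>\<^sub>M (borel :: real measure))"
      using B by (intro pair_measureI) auto
    have "emeasure (distr (signal_density \<mu> f) borel snd) B = emeasure (signal_density \<mu> f) (UNIV \<times> B)"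
      by (subst emeasure_distr[OF ms B]) (auto simp: sp intro!: arg_cong[of _ _ "emeasure _"])
    also have "\<dots> = emeasure \<mu> B"
      unfolding em[OF UB] using nn_integral_signal_sum[OF B] by (simp add: indicator_times)
    finally show "emeasure (distr (signal_density \<mu> f) borel snd) B = emeasure \<mu> B" .
  qed (simp add: \<mu>)
  ultimately show ?thesis
    unfolding info_structure_def using finite ps sets_signal_density[OF \<mu>(2)] by blast
qed

text \<open>Restricting the joint distribution to one signal pair avoids any integrability side condition.\<close>

lemma density_signal_cell:
  "density (signal_density \<mu> f) (indicator ({k} \<times> UNIV))
   = distr (density \<mu> (\<lambda>v. ennreal (f k v))) (count_space UNIV \<Otimes>\<^sub>M borel) (Pair k)" (is "?L = ?R")
proof (rule measure_eqI)
  have s: "sets (signal_density \<mu> f) = sets (count_space UNIV \<Otimes>\<^sub>M borel)"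
    by (rule sets_signal_density[OF \<mu>(2)])
  show "sets ?L = sets ?R" using s by simp
  have fk: "(\<lambda>v. ennreal (f k v)) \<in> borel_measurable \<mu>"
    using f[of k] by (simp add: measurable_cong_sets[OF \<mu>(2) refl])
  have mP: "Pair k \<in> density \<mu> (\<lambda>v. ennreal (f k v)) \<rightarrow>\<^sub>M count_space UNIV \<Otimes>\<^sub>M borel"
    by (subst measurable_cong_sets[OF trans[OF sets_density \<mu>(2)] refl]) (rule measurable_Pair1', simp)
  fix A assume "A \<in> sets ?L"
  then have A: "A \<in> sets (count_space UNIV \<Otimes>\<^sub>M borel)" using s by simp
  have k: "{k} \<times> UNIV \<in> sets (count_space (UNIV :: (nat\<times>nat) set) \<Otimes>\<^sub>M (borel :: real measure))"
    by (intro pair_measureI) auto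
  then have kA: "({k} \<times> UNIV) \<inter> A \<in> sets (count_space (UNIV :: (nat\<times>nat) set) \<Otimes>\<^sub>M (borel :: real measure))"
    using A by blast
  have "emeasure ?L A = (\<integral>\<^sup>+x. indicator ({k} \<times> UNIV) x * indicator A x \<partial>signal_density \<mu> f)"
    using A s k by (subst emeasure_density) auto
  also have "\<dots> = (\<integral>\<^sup>+x. indicator (({k} \<times> UNIV) \<inter> A) x \<partial>signal_density \<mu> f)"
    by (simp only: indicator_inter_arith)
  also have "\<dots> = emeasure (signal_density \<mu> f) (({k} \<times> UNIV) \<inter> A)"
    using kA s by (intro nn_integral_indicator) simp
  also have "\<dots> = (\<integral>\<^sup>+j. (\<integral>\<^sup>+v. ennreal (f j v) * indicator (({k} \<times> UNIV) \<inter> A) (j, v) \<partial>\<mu>) \<partial>count_space UNIV)"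
    by (rule emeasure_signal_density[OF \<mu> f kA])
  also have "\<dots> = (\<Sum>j\<in>{k}. (\<integral>\<^sup>+v. ennreal (f j v) * indicator (({k} \<times> UNIV) \<inter> A) (j, v) \<partial>\<mu>))"
    by (rule nn_integral_count_space') auto
  also have "\<dots> = (\<integral>\<^sup>+v. ennreal (f k v) * indicator (Pair k -` A) v \<partial>\<mu>)"
    by (auto intro!: nn_integral_cong simp: indicator_def)
  also have "\<dots> = emeasure ?R A"
  proof -
    have "Pair k -` A \<in> sets \<mu>" using sets_Pair1[OF A, of k] \<mu>(2) by simp
    moreover have "space \<mu> = UNIV" using sets_eq_imp_space_eq[OF \<mu>(2)] by simp
    ultimately show ?thesis
      by (simp add: emeasure_distr[OF mP A] emeasure_density[OF fk])
  qed
  finally show "emeasure ?L A = emeasure ?R A" .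
qed

lemma integral_signal_cell:
  assumes h: "h \<in> borel_measurable borel"
  shows "(\<integral>x. indicator ({k} \<times> UNIV) x * h (snd x) \<partial>signal_density \<mu> f) = (\<integral>v. f k v * h v \<partial>\<mu>)"
proof -
  have s: "sets (signal_density \<mu> f) = sets (count_space UNIV \<Otimes>\<^sub>M borel)"
    by (rule sets_signal_density[OF \<mu>(2)])
  have k: "{k} \<times> UNIV \<in> sets (count_space (UNIV :: (nat\<times>nat) set) \<Otimes>\<^sub>M (borel :: real measure))"
    by (intro pair_measureI) auto
  have hs: "(\<lambda>x. h (snd x)) \<in> borel_measurable (count_space (UNIV :: (nat\<times>nat) set) \<Otimes>\<^sub>M borel)"
    using h by measurable
  have fk: "f k \<in> borel_measurable \<mu>" and hm: "h \<in> borel_measurable \<mu>"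
    using f[of k] h by (simp_all add: measurable_cong_sets[OF \<mu>(2) refl])
  have mP: "Pair k \<in> density \<mu> (\<lambda>v. ennreal (f k v)) \<rightarrow>\<^sub>M count_space UNIV \<Otimes>\<^sub>M borel"
    by (subst measurable_cong_sets[OF trans[OF sets_density \<mu>(2)] refl]) (rule measurable_Pair1', simp)
  have "(\<integral>x. indicator ({k} \<times> UNIV) x * h (snd x) \<partial>signal_density \<mu> f)
     = (\<integral>x. h (snd x) \<partial>density (signal_density \<mu> f) (\<lambda>x. ennreal (indicator ({k} \<times> UNIV) x)))"
    using hs k s by (subst integral_density) (auto simp: measurable_cong_sets[OF s refl])
  also have "\<dots> = (\<integral>x. h (snd x) \<partial>distr (density \<mu> (\<lambda>v. ennreal (f k v))) (count_space UNIV \<Otimes>\<^sub>M borel) (Pair k))"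
    using density_signal_cell[of k] by (simp add: ennreal_indicator)
  also have "\<dots> = (\<integral>v. h v \<partial>density \<mu> (\<lambda>v. ennreal (f k v)))"
    by (subst integral_distr[OF mP hs]) simp
  also have "\<dots> = (\<integral>v. f k v * h v \<partial>\<mu>)"
    using hm fk by (subst integral_density) (auto simp: nonneg)
  finally show ?thesis .
qed

lemma sig_prob_signal_density:
  "sig_prob (signal_density \<mu> f) ts tb = (\<integral>v. f (ts, tb) v \<partial>\<mu>)"
proof -
  have sp: "space (signal_density \<mu> f) = UNIV"
    using sets_eq_imp_space_eq[OF sets_signal_density[OF \<mu>(2)], of f] by (simp add: space_pair_measure)
  have k: "{(ts, tb)} \<times> UNIV \<in> sets (signal_density \<mu> f)"
    unfolding sets_signal_density[OF \<mu>(2)] by (intro pair_measureI) auto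
  have "(\<integral>x. indicator ({(ts, tb)} \<times> UNIV) x * 1 \<partial>signal_density \<mu> f) = (\<integral>v. f (ts, tb) v * 1 \<partial>\<mu>)"
    by (rule integral_signal_cell) auto
  then show ?thesis using k by (simp add: sig_prob_def sp)
qed

text \<open>The indicator of \<open>V\<close> is moved from the signal cell into the integrand, so
  that nothing is asked of \<open>h\<close> off \<open>V\<close>, where \<open>c\<close> is
  arbitrary.\<close>

lemma cond_exp_signal_density:
  assumes h: "(\<lambda>v. indicator V v * h v) \<in> borel_measurable borel"
  shows "cond_exp V (signal_density \<mu> f) h ts tb
    = (\<integral>v. f (ts, tb) v * (indicator V v * h v) \<partial>\<mu>) / (\<integral>v. f (ts, tb) v \<partial>\<mu>)"
proof -
  have "(\<integral>x. indicator ({(ts, tb)} \<times> V) x * h (snd x) \<partial>signal_density \<mu> f)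
     = (\<integral>x. indicator ({(ts, tb)} \<times> UNIV) x * (indicator V (snd x) * h (snd x)) \<partial>signal_density \<mu> f)"
    by (intro Bochner_Integration.integral_cong) (auto simp: indicator_def)
  also have "\<dots> = (\<integral>v. f (ts, tb) v * (indicator V v * h v) \<partial>\<mu>)"
    by (rule integral_signal_cell[OF h])
  finally show ?thesis by (simp add: cond_exp_def sig_prob_signal_density)
qed

end


section \<open>A family of sequential equilibria\<close>

lemma seller_optimalI:
  fixes \<sigma> \<tau> val :: "real \<Rightarrow> real"
  assumes "\<And>p. p \<in> G \<Longrightarrow> val p \<le> M" and "\<And>p. p \<in> G \<Longrightarrow> \<sigma> p \<noteq> 0 \<Longrightarrow> val p = M"
    and "(\<Sum>p\<in>G. \<sigma> p) = 1" and "\<forall>p\<in>G. \<tau> p \<ge> 0" and "(\<Sum>p\<in>G. \<tau> p) = 1"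
  shows "(\<Sum>p\<in>G. \<tau> p * val p) \<le> (\<Sum>p\<in>G. \<sigma> p * val p)"
proof -
  have "(\<Sum>p\<in>G. \<tau> p * val p) \<le> (\<Sum>p\<in>G. \<tau> p * M)"
    using assms by (intro sum_mono mult_left_mono) auto
  also have "\<dots> = (\<Sum>p\<in>G. \<sigma> p * M)"
    using assms by (simp flip: sum_distrib_right)
  also have "\<dots> = (\<Sum>p\<in>G. \<sigma> p * val p)"
    using assms(2) by (intro sum.cong refl) (metis mult_zero_left)
  finally show ?thesis .
qed

lemma buyer_optimalI:
  fixes b \<beta> x :: real
  assumes "0 \<le> b" "b \<le> 1" and "x > 0 \<Longrightarrow> \<beta> = 1" and "x < 0 \<Longrightarrow> \<beta> = 0"
  shows "b * x \<le> \<beta> * x"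
  using assms by (cases x "0::real" rule: linorder_cases) (auto simp: mult_nonneg_nonpos)

text \<open>\<open>p1\<close> will set the seller's payoff, and \<open>x\<close> will then set the
  buyer's.\<close>

definition mix_seller :: "real \<Rightarrow> real \<Rightarrow> real \<Rightarrow> nat \<Rightarrow> real \<Rightarrow> real" where
  "mix_seller p1 p2 x ts p =
     (if p = p1 then (if ts = 2 then x else 1) else if p = p2 \<and> ts = 2 then 1 - x else 0)"

text \<open>\<open>q\<close> will make seller type 2 indifferent between \<open>p1\<close> and
  \<open>p2\<close>. Only buyer type 1 can meet that seller type, so for buyer type 0 the price
  \<open>p2\<close> is as unexpected as any other.\<close>

definition mix_buyer :: "real \<Rightarrow> real \<Rightarrow> real \<Rightarrow> real \<Rightarrow> nat \<Rightarrow> real \<Rightarrow> real" where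
  "mix_buyer p1 p2 q w tb p =
     (if p < w \<or> p = p1 then 1 else if p = p2 \<and> tb = 1 then q else 0)"

text \<open>The last case attributes a deviation to the lowest seller type that the buyer considers
  possible, which in the signal structure below happens to have the same number as the buyer type.\<close>

definition mix_belief ::
  "((nat \<times> nat) \<times> real) measure \<Rightarrow> real \<Rightarrow> real \<Rightarrow> real \<Rightarrow> nat \<Rightarrow> real \<Rightarrow> nat \<Rightarrow> real" where
  "mix_belief P p1 p2 x tb p ts =
     (if p = p1 then bayes_belief P {0,1,2} (mix_seller p1 p2 x) tb p ts
      else if p = p2 \<and> tb = 1 then (if ts = 2 then 1 else 0)
      else if ts = tb then 1 else 0)"

text \<open>As \<open>e\<close> tends to \<open>0\<close>, lower types tremble infinitely more often than higher ones.\<close>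

definition tremble :: "real set \<Rightarrow> (nat \<Rightarrow> real \<Rightarrow> real) \<Rightarrow> real \<Rightarrow> nat \<Rightarrow> real \<Rightarrow> real" where
  "tremble G \<sigma> e ts p = (1 - real (card G) * e ^ (ts + 1)) * \<sigma> ts p + e ^ (ts + 1)"

text \<open>A tremble mixes the strategy with the uniform distribution on \<open>G\<close>, the
  latter with total weight \<open>card G * e ^ (ts + 1)\<close>; the assumptions on \<open>e\<close>
  keep this weight at most 1.\<close>

lemma tremble_fully_mixed:
  assumes "finite G" "seller_strategy Ts G \<sigma>" "0 < e" "e \<le> 1" "real (card G) * e \<le> 1"
  shows "fully_mixed_seller Ts G (tremble G \<sigma> e)"
  unfolding fully_mixed_seller_def
proof (intro ballI conjI)
  fix ts assume ts: "ts \<in> Ts"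
  have "real (card G) * e ^ (ts + 1) \<le> real (card G) * e"
    using assms(3,4) by (intro mult_left_mono) (auto simp: mult_left_le power_le_one)
  then have "1 - real (card G) * e ^ (ts + 1) \<ge> 0" using assms(5) by linarith
  then show "tremble G \<sigma> e ts p > 0" if "p \<in> G" for p
    using assms ts that unfolding tremble_def seller_strategy_def
    by (intro add_nonneg_pos mult_nonneg_nonneg) auto
  have "(\<Sum>p\<in>G. \<sigma> ts p) = 1" using assms ts unfolding seller_strategy_def by blast
  then show "(\<Sum>p\<in>G. tremble G \<sigma> e ts p) = 1"
    by (simp add: tremble_def sum.distrib flip: sum_distrib_left)
qed

text \<open>The exponent \<open>ts + 1\<close> instead of \<open>ts\<close> makes the trembles of
  type 0 vanish too.\<close>

lemma tendsto_tremble: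
  assumes "e \<longlonglongrightarrow> 0"
  shows "(\<lambda>k. tremble G \<sigma> (e k) ts p) \<longlonglongrightarrow> \<sigma> ts p"
proof -
  have "(\<lambda>k. (1 - real (card G) * e k ^ (ts + 1)) * \<sigma> ts p + e k ^ (ts + 1))
      \<longlonglongrightarrow> (1 - real (card G) * 0 ^ (ts + 1)) * \<sigma> ts p + 0 ^ (ts + 1)"
    by (intro tendsto_intros assms)
  then show ?thesis by (simp add: tremble_def)
qed

lemma tendsto_bayes_belief:
  assumes "\<And>ts. ts \<in> Ts \<Longrightarrow> (\<lambda>k. \<sigma>n k ts p) \<longlonglongrightarrow> \<sigma> ts p"
    and "(\<Sum>ts\<in>Ts. sig_prob P ts tb * \<sigma> ts p) \<noteq> 0" and "ts \<in> Ts"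
  shows "(\<lambda>k. bayes_belief P Ts (\<sigma>n k) tb p ts) \<longlonglongrightarrow> bayes_belief P Ts \<sigma> tb p ts"
  unfolding bayes_belief_def using assms by (intro tendsto_intros) auto

text \<open>These are the Bayes weights of seller types \<open>n\<close> and \<open>n + 1\<close>,
  of joint probabilities \<open>s\<close> and \<open>r\<close>, at a price that both post only by
  trembling. Cancelling \<open>e k ^ (n + 1)\<close> shows that the lower type takes the whole
  belief.\<close>

lemma tendsto_tremble_ratio:
  fixes e :: "nat \<Rightarrow> real"
  assumes e: "e \<longlonglongrightarrow> 0" "\<And>k. e k > 0" and s: "s > 0" "r \<ge> 0"
  shows "(\<lambda>k. s * e k ^ (n + 1) / (s * e k ^ (n + 1) + r * e k ^ (n + 2))) \<longlonglongrightarrow> 1"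
    and "(\<lambda>k. r * e k ^ (n + 2) / (s * e k ^ (n + 1) + r * e k ^ (n + 2))) \<longlonglongrightarrow> 0"
proof -
  have 1: "s * e k ^ (n + 1) / (s * e k ^ (n + 1) + r * e k ^ (n + 2)) = s / (s + r * e k)" for k
  proof -
    have "s * e k ^ (n + 1) + r * e k ^ (n + 2) = (s + r * e k) * e k ^ (n + 1)"
      by (simp add: algebra_simps)
    then show ?thesis using e(2)[of k] by simp
  qed
  have 2: "r * e k ^ (n + 2) / (s * e k ^ (n + 1) + r * e k ^ (n + 2)) = r * e k / (s + r * e k)" for k
  proof -
    have "s * e k ^ (n + 1) + r * e k ^ (n + 2) = (s + r * e k) * e k ^ (n + 1)"
      "r * e k ^ (n + 2) = r * e k * e k ^ (n + 1)"
      by (simp_all add: algebra_simps)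
    then show ?thesis using e(2)[of k] by simp
  qed
  have "(\<lambda>k. s / (s + r * e k)) \<longlonglongrightarrow> s / (s + r * 0)"
    using s by (intro tendsto_intros e) auto
  then show "(\<lambda>k. s * e k ^ (n + 1) / (s * e k ^ (n + 1) + r * e k ^ (n + 2))) \<longlonglongrightarrow> 1"
    using s unfolding 1 by simp
  have "(\<lambda>k. r * e k / (s + r * e k)) \<longlonglongrightarrow> r * 0 / (s + r * 0)"
    using s by (intro tendsto_intros e) auto
  then show "(\<lambda>k. r * e k ^ (n + 2) / (s * e k ^ (n + 1) + r * e k ^ (n + 2))) \<longlonglongrightarrow> 0"
    using s unfolding 2 by simp
qed

text \<open>The positive pairs link the types in a chain: seller 0, buyer 0, seller 1, buyer 1,
  seller 2. Each buyer type meets two neighbouring seller types, and the lower of them comes with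
  value \<open>w\<close>. Seller type 1 meets both buyer types, which is what will keep it from
  posting \<open>p2\<close>.\<close>

locale chain_structure =
  fixes V :: "real set" and c :: "real \<Rightarrow> real" and P :: "((nat \<times> nat) \<times> real) measure"
    and s \<theta> r w Ev p2 cl Ec cr :: real
  assumes s_pos: "s > 0" and \<theta>_pos: "\<theta> > 0" and r_pos: "r > 0"
    and sig: "sig_prob P 0 0 = s" "sig_prob P (Suc 0) 0 = \<theta>" "sig_prob P (Suc 0) (Suc 0) = s" "sig_prob P 2 (Suc 0) = r"
      "sig_prob P 2 0 = 0" "sig_prob P 0 (Suc 0) = 0"
    and val: "cond_exp V P (\<lambda>v. v) 0 0 = w" "cond_exp V P (\<lambda>v. v) (Suc 0) 0 = Ev"
      "cond_exp V P (\<lambda>v. v) (Suc 0) (Suc 0) = w" "cond_exp V P (\<lambda>v. v) 2 (Suc 0) = p2"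
    and cost: "cond_exp V P c 0 0 = cl" "cond_exp V P c (Suc 0) 0 = Ec"
      "cond_exp V P c (Suc 0) (Suc 0) = cl" "cond_exp V P c 2 (Suc 0) = cr"
begin

lemma mix_consistent:
  assumes fin: "finite G" and p1: "p1 \<in> G" and p2: "p2 \<in> G" and ne: "p1 \<noteq> p2"
    and x: "0 < x" "x < 1"
    and bs: "buyer_strategy {0,1} G \<beta>"
  shows "consistent P {0,1,2} {0,1} G (mix_seller p1 p2 x) \<beta> (mix_belief P p1 p2 x)"
proof -
  let ?\<sigma> = "mix_seller p1 p2 x"
  \<comment> \<open>The denominator ensures \<open>card G * e k \<le> 1\<close>.\<close>
  define e where "e = (\<lambda>k. inverse (real (Suc k)) / (real (card G) + 1))"
  have ep: "e k > 0" for k by (simp add: e_def add_nonneg_pos)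
  have ee: "e k \<le> 1 / (real (card G) + 1)" for k
    unfolding e_def by (intro divide_right_mono) (auto simp: inverse_le_1_iff)
  have e1: "e k \<le> 1" for k using ee[of k] by (rule order_trans) simp
  have eN: "real (card G) * e k \<le> 1" for k
  proof -
    have "real (card G) * e k \<le> real (card G) * (1 / (real (card G) + 1))" by (intro mult_left_mono ee) simp
    also have "\<dots> \<le> 1" by simp
    finally show ?thesis .
  qed
  have e0: "e \<longlonglongrightarrow> 0"
    unfolding e_def using tendsto_divide[OF LIMSEQ_inverse_real_of_nat tendsto_const[of "real (card G) + 1"]] by (simp add: add_nonneg_eq_0_iff)
  have ss: "seller_strategy {0,1,2} G ?\<sigma>"
    unfolding seller_strategy_def
  proof (intro ballI conjI)
    fix ts :: nat assume "ts \<in> {0,1,2}"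
    show "0 \<le> ?\<sigma> ts p" for p using x by (simp add: mix_seller_def)
    have "(\<Sum>p\<in>G. ?\<sigma> ts p) = (\<Sum>p\<in>{p1,p2}. ?\<sigma> ts p)"
      using fin p1 p2 by (intro sum.mono_neutral_right) (auto simp: mix_seller_def)
    then show "(\<Sum>p\<in>G. ?\<sigma> ts p) = 1" using ne by (simp add: mix_seller_def)
  qed
  \<comment> \<open>Beliefs depend on the seller's trembles only, so any interior perturbation
    tending to \<open>\<beta>\<close> serves; this one pulls towards 1/2.\<close>
  define \<beta>n where "\<beta>n = (\<lambda>k tb p. (1 - e k / 2) * \<beta> tb p + (e k / 2) * (1/2))"
  have bfm: "fully_mixed_buyer {0,1} G (\<beta>n k)" for k
    unfolding fully_mixed_buyer_def
  proof (intro ballI conjI)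
    fix tb p assume "tb \<in> {0,1::nat}" "p \<in> G"
    then have b: "0 \<le> \<beta> tb p" "\<beta> tb p \<le> 1" using bs unfolding buyer_strategy_def by auto
    have h: "0 < e k / 2" "0 \<le> 1 - e k / 2" using ep[of k] e1[of k] by auto
    have "0 \<le> (1 - e k / 2) * \<beta> tb p" by (rule mult_nonneg_nonneg[OF h(2) b(1)])
    then show "0 < \<beta>n k tb p" unfolding \<beta>n_def using h by linarith
    have "(1 - e k / 2) * \<beta> tb p \<le> (1 - e k / 2) * 1" by (rule mult_left_mono[OF b(2) h(2)])
    then have "\<beta>n k tb p \<le> (1 - e k / 2) * 1 + (e k / 2) * (1/2)"
      unfolding \<beta>n_def by (rule add_right_mono)
    also have "\<dots> < 1" using h by simp
    finally show "\<beta>n k tb p < 1" .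
  qed
  have blim: "(\<lambda>k. \<beta>n k tb p) \<longlonglongrightarrow> \<beta> tb p" for tb p
  proof -
    have "(\<lambda>k. \<beta>n k tb p) \<longlonglongrightarrow> (1 - 0 / 2) * \<beta> tb p + (0 / 2) * (1/2)"
      unfolding \<beta>n_def by (intro tendsto_intros e0) auto
    then show ?thesis by simp
  qed
  have bel: "(\<lambda>k. bayes_belief P {0,1,2} (tremble G ?\<sigma> (e k)) tb p ts) \<longlonglongrightarrow> mix_belief P p1 p2 x tb p ts"
    if tb: "tb \<in> {0,1}" and p: "p \<in> G" and ts: "ts \<in> {0,1,2}" for tb p ts
  proof -
    \<comment> \<open>Sets of the first two kinds are reached with positive probability, so their
      limit is Bayes' rule. At the rest only trembles matter; this includes \<open>p2\<close> for
      buyer type 0, since the pair (2,0) is null.\<close>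
    consider (path) "p = p1" | (high) "p = p2" "tb = 1" | (off) "p \<noteq> p1" "\<not> (p = p2 \<and> tb = 1)" by blast
    then show ?thesis
    proof cases
      case path
      have "(\<Sum>ts\<in>{0,1,2}. sig_prob P ts tb * ?\<sigma> ts p) > 0"
        using tb x path s_pos \<theta>_pos r_pos by (auto simp: sig mix_seller_def add_pos_pos)
      then show ?thesis
        using path tendsto_bayes_belief[of "{0,1,2}" "\<lambda>k. tremble G ?\<sigma> (e k)" p ?\<sigma> P tb ts] ts tendsto_tremble[OF e0]
        by (simp add: mix_belief_def)
    next
      case high
      have "(\<Sum>ts\<in>{0,1,2}. sig_prob P ts tb * ?\<sigma> ts p) = r * (1 - x)"
        using high ne by (simp add: sig mix_seller_def)
      moreover have "bayes_belief P {0,1,2} ?\<sigma> tb p ts = mix_belief P p1 p2 x tb p ts"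
        using high ne ts x r_pos by (auto simp: bayes_belief_def sig mix_seller_def mix_belief_def)
      ultimately show ?thesis
        using tendsto_bayes_belief[of "{0,1,2}" "\<lambda>k. tremble G ?\<sigma> (e k)" p ?\<sigma> P tb ts] ts tendsto_tremble[OF e0] x r_pos
        by simp
    next
      case off
      show ?thesis
      proof (cases "tb = 0")
        case True
        have a: "tremble G ?\<sigma> (e k) 0 p = e k ^ (0 + 1)" "tremble G ?\<sigma> (e k) (Suc 0) p = e k ^ (0 + 2)" for k
          using off by (simp_all add: tremble_def mix_seller_def eval_nat_numeral)
        show ?thesis
          using ts True off tendsto_tremble_ratio[OF e0 ep s_pos less_imp_le[OF \<theta>_pos], of 0]
          by (auto simp: bayes_belief_def sig a mix_belief_def)
      next
        case False
        then have t1: "tb = 1" using tb by simp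
        then have a: "tremble G ?\<sigma> (e k) (Suc 0) p = e k ^ (1 + 1)" "tremble G ?\<sigma> (e k) 2 p = e k ^ (1 + 2)" for k
          using off by (simp_all add: tremble_def mix_seller_def eval_nat_numeral)
        show ?thesis
          using ts t1 off tendsto_tremble_ratio[OF e0 ep s_pos less_imp_le[OF r_pos], of 1]
          by (auto simp: bayes_belief_def sig a mix_belief_def)
      qed
    qed
  qed
  show ?thesis
    unfolding consistent_def
  proof (rule exI[of _ "\<lambda>k. tremble G ?\<sigma> (e k)"], rule exI[of _ \<beta>n], intro conjI allI ballI impI)
    show "fully_mixed_seller {0,1,2} G (tremble G ?\<sigma> (e k))" for k
      by (rule tremble_fully_mixed[OF fin ss ep e1 eN])
  qed (assumption | rule bfm tendsto_tremble[OF e0] blim bel)+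
qed

text \<open>\<open>b0\<close> and \<open>b1\<close> say that buyer types 0 and 1 accept
  \<open>p1\<close> under their Bayes beliefs. At \<open>p2\<close> buyer type 1 is sure to face
  type 2, where the value is exactly \<open>p2\<close>, so any \<open>q\<close> is optimal; the
  chosen one makes seller type 2 indifferent. By \<open>dev\<close>, posting \<open>p2\<close> costs
  seller type 1 more against buyer type 0, who rejects it, than the at most
  \<open>s * (p2 - p1)\<close> gained from buyer type 1. Seller type 0 sells at \<open>p2\<close> to
  nobody.\<close>

lemma mix_sequential_equilibrium:
  assumes fin: "finite G" and p1: "p1 \<in> G" and p2: "p2 \<in> G"
    and x: "0 < x" "x < 1" and lt: "w < p1" "p1 < p2"
    and cl: "cl \<le> w" and cr: "cr \<le> p1" and Ec: "Ec \<le> p1"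
    and b0: "s * (p1 - w) \<le> \<theta> * (Ev - p1)"
    and b1: "s * (p1 - w) \<le> r * x * (p2 - p1)"
    and dev: "s * (p2 - p1) \<le> \<theta> * (p1 - Ec)"
    and q: "q = (p1 - cr) / (p2 - cr)"
  shows "sequential_equilibrium V c P {0,1,2} {0,1} G (mix_seller p1 p2 x) (mix_buyer p1 p2 q w) (mix_belief P p1 p2 x)"
proof -
  let ?\<sigma> = "mix_seller p1 p2 x" and ?\<beta> = "mix_buyer p1 p2 q w" and ?\<psi> = "mix_belief P p1 p2 x"
  have q01: "0 \<le> q" "q \<le> 1" and q2: "q * (p2 - cr) = p1 - cr"
    using cr lt unfolding q by auto
  have bs: "buyer_strategy {0,1} G ?\<beta>"
    using q01 by (auto simp: buyer_strategy_def mix_buyer_def)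
  have sum1: "(\<Sum>p\<in>G. ?\<sigma> ts p) = 1" for ts
  proof -
    have "(\<Sum>p\<in>G. ?\<sigma> ts p) = (\<Sum>p\<in>{p1,p2}. ?\<sigma> ts p)"
      using fin p1 p2 by (intro sum.mono_neutral_right) (auto simp: mix_seller_def)
    then show ?thesis using lt by (simp add: mix_seller_def)
  qed
  then have ss: "seller_strategy {0,1,2} G ?\<sigma>"
    using x by (auto simp: seller_strategy_def mix_seller_def)
  have cons: "consistent P {0,1,2} {0,1} G ?\<sigma> ?\<beta> ?\<psi>"
    by (rule mix_consistent[OF fin p1 p2 _ x bs]) (use lt in simp)
  have seller: "(\<Sum>p\<in>G. \<tau> p * seller_value V c P {0,1} ?\<beta> ts p)
             \<le> (\<Sum>p\<in>G. ?\<sigma> ts p * seller_value V c P {0,1} ?\<beta> ts p)"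
    if ts: "ts \<in> {0,1,2}" and \<tau>: "\<forall>p\<in>G. \<tau> p \<ge> 0" "(\<Sum>p\<in>G. \<tau> p) = 1" for ts \<tau>
  proof (rule seller_optimalI[OF _ _ sum1 \<tau>, where M = "seller_value V c P {0,1} ?\<beta> ts p1"])
    consider "ts = 0" | "ts = 1" | "ts = 2" using ts by auto
    then have "seller_value V c P {0,1} ?\<beta> ts p \<le> seller_value V c P {0,1} ?\<beta> ts p1 \<and>
         (?\<sigma> ts p \<noteq> 0 \<longrightarrow> seller_value V c P {0,1} ?\<beta> ts p = seller_value V c P {0,1} ?\<beta> ts p1)" for p
    proof cases
      case 1
      have v: "seller_value V c P {0,1} ?\<beta> ts p = ?\<beta> 0 p * (p - cl)" for p
        using s_pos 1 by (simp add: seller_value_def seller_sig_prob_def sig cost)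
      show ?thesis unfolding v using 1 lt cl by (auto simp: mix_buyer_def mix_seller_def)
    next
      case 2
      have v: "seller_value V c P {0,1} ?\<beta> ts p = (\<theta> * (?\<beta> 0 p * (p - Ec)) + s * (?\<beta> 1 p * (p - cl))) / (\<theta> + s)" for p
        using 2 by (simp add: seller_value_def seller_sig_prob_def sig cost add_divide_distrib)
      have "\<theta> * (?\<beta> 0 p * (p - Ec)) + s * (?\<beta> 1 p * (p - cl)) \<le> \<theta> * (?\<beta> 0 p1 * (p1 - Ec)) + s * (?\<beta> 1 p1 * (p1 - cl))"
      proof -
        consider "p < w \<or> p = p1" | "p = p2" | "\<not> p < w" "p \<noteq> p1" "p \<noteq> p2" by blast
        then show ?thesis
        proof cases
          case 1
          then have "p \<le> p1" using lt by auto
          then show ?thesis using 1 s_pos \<theta>_pos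
            by (auto simp: mix_buyer_def intro!: add_mono mult_left_mono)
        next
          case 2
          have "s * (q * (p2 - cl)) \<le> s * (1 * (p2 - cl))"
            using s_pos q01 lt cl by (intro mult_left_mono mult_right_mono) auto
          also have "\<dots> \<le> \<theta> * (p1 - Ec) + s * (p1 - cl)" using dev by (simp add: algebra_simps)
          finally show ?thesis using 2 lt by (simp add: mix_buyer_def)
        next
          case 3
          have "0 \<le> \<theta> * (p1 - Ec) + s * (p1 - cl)"
            using s_pos \<theta>_pos Ec lt cl by (intro add_nonneg_nonneg mult_nonneg_nonneg) auto
          then show ?thesis using 3 by (simp add: mix_buyer_def)
        qed
      qed
      then show ?thesis unfolding v using 2 s_pos \<theta>_pos
        by (auto simp: mix_seller_def divide_le_cancel split: if_splits)
    next
      case 3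
      have v: "seller_value V c P {0,1} ?\<beta> ts p = ?\<beta> 1 p * (p - cr)" for p
        using r_pos 3 by (simp add: seller_value_def seller_sig_prob_def sig cost)
      show ?thesis unfolding v using 3 lt cr q2 by (auto simp: mix_buyer_def mix_seller_def)
    qed
    then show "seller_value V c P {0,1} ?\<beta> ts p \<le> seller_value V c P {0,1} ?\<beta> ts p1"
      and "?\<sigma> ts p \<noteq> 0 \<Longrightarrow> seller_value V c P {0,1} ?\<beta> ts p = seller_value V c P {0,1} ?\<beta> ts p1" for p
      by blast+
  qed
  have buyer: "b * buyer_value V P {0,1,2} ?\<psi> tb p \<le> ?\<beta> tb p * buyer_value V P {0,1,2} ?\<psi> tb p"
    if tb: "tb \<in> {0,1}" and b: "0 \<le> b" "b \<le> 1" for tb p b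
  proof -
    consider (path) "p = p1" | (high) "p = p2" "tb = 1" | (off) "p \<noteq> p1" "\<not> (p = p2 \<and> tb = 1)" by blast
    then show ?thesis
    proof cases
      case path
      have "buyer_value V P {0,1,2} ?\<psi> tb p \<ge> 0"
      proof (cases "tb = 0")
        case True
        have "buyer_value V P {0,1,2} ?\<psi> tb p = (s * (w - p1) + \<theta> * (Ev - p1)) / (s + \<theta>)"
          using True path lt by (simp add: buyer_value_def mix_belief_def bayes_belief_def mix_seller_def sig val add_divide_distrib)
        also have "\<dots> \<ge> 0" using b0 s_pos \<theta>_pos by (simp add: algebra_simps)
        finally show ?thesis .
      next
        case False
        then have "buyer_value V P {0,1,2} ?\<psi> tb p = (s * (w - p1) + r * x * (p2 - p1)) / (s + r * x)"
          using tb path lt by (simp add: buyer_value_def mix_belief_def bayes_belief_def mix_seller_def sig val add_divide_distrib)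
        also have "\<dots> \<ge> 0"
          using b1 s_pos r_pos x by (intro divide_nonneg_pos add_pos_pos mult_pos_pos) (simp_all add: algebra_simps)
        finally show ?thesis .
      qed
      then show ?thesis by (intro buyer_optimalI b) (use path in \<open>auto simp: mix_buyer_def\<close>)
    next
      case high
      then have "buyer_value V P {0,1,2} ?\<psi> tb p = 0"
        using lt by (simp add: buyer_value_def mix_belief_def val)
      then show ?thesis by simp
    next
      case off
      then have "buyer_value V P {0,1,2} ?\<psi> tb p = w - p"
        using tb by (auto simp: buyer_value_def mix_belief_def val)
      then show ?thesis by (intro buyer_optimalI b) (use off in \<open>auto simp: mix_buyer_def\<close>)
    qed
  qed
  show ?thesis
    unfolding sequential_equilibrium_def sequentially_rational_def
    using ss bs cons seller buyer by blast
qed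

text \<open>The seller's payoff is free of \<open>x\<close> because type 2 is indifferent: it may be
  computed as if every type sold at \<open>p1\<close> for sure.\<close>

lemma mix_payoffs:
  assumes fin: "finite G" and p1: "p1 \<in> G" and p2: "p2 \<in> G"
    and lt: "w < p1" "p1 < p2" and cr: "cr \<le> p1"
    and q: "q = (p1 - cr) / (p2 - cr)"
  shows "buyer_payoff V P {0,1,2} {0,1} G (mix_seller p1 p2 x) (mix_buyer p1 p2 q w)
           = 2 * s * (w - p1) + \<theta> * (Ev - p1) + x * r * (p2 - p1)" (is ?B)
    and "seller_payoff V c P {0,1,2} {0,1} G (mix_seller p1 p2 x) (mix_buyer p1 p2 q w)
           = (2 * s + \<theta> + r) * p1 - (2 * s * cl + \<theta> * Ec + r * cr)" (is ?S)
proof -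
  have q2: "q * (p2 - cr) = p1 - cr" using cr lt unfolding q by auto
  have two: "(\<Sum>p\<in>G. mix_seller p1 p2 x ts p * mix_buyer p1 p2 q w tb p * g p)
      = (\<Sum>p\<in>{p1,p2}. mix_seller p1 p2 x ts p * mix_buyer p1 p2 q w tb p * g p)" for ts tb g
    using fin p1 p2 by (intro sum.mono_neutral_right) (auto simp: mix_seller_def)
  show ?B
    unfolding buyer_payoff_def two using lt
    by (simp add: sig val mix_seller_def mix_buyer_def algebra_simps)
  have "seller_payoff V c P {0,1,2} {0,1} G (mix_seller p1 p2 x) (mix_buyer p1 p2 q w)
      = s * (p1 - cl) + \<theta> * (p1 - Ec) + s * (p1 - cl) + r * (x * (p1 - cr) + (1 - x) * (q * (p2 - cr)))"
    unfolding seller_payoff_def two using lt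
    by (simp add: sig cost mix_seller_def mix_buyer_def)
  also have "\<dots> = (2 * s + \<theta> + r) * p1 - (2 * s * cl + \<theta> * Ec + r * cr)"
    unfolding q2 by (simp add: algebra_simps)
  finally show ?S .
qed

end


section \<open>Information structures for an environment\<close>

text \<open>The complement of the support is a union of open null sets; by Lindelof countably many
  of them cover it.\<close>

lemma AE_measure_support:
  fixes \<mu> :: "real measure"
  assumes s: "sets \<mu> = sets borel"
  shows "AE v in \<mu>. v \<in> measure_support \<mu>"
proof -
  let ?F = "{U. open U \<and> emeasure \<mu> U = 0}"
  obtain F' where F': "F' \<subseteq> ?F" "countable F'" "\<Union>F' = \<Union>?F"
    using Lindelof[of ?F] by auto
  have "F' \<subseteq> null_sets \<mu>" using F'(1) s by (auto simp: null_sets_def)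
  then have "\<Union>F' \<in> null_sets \<mu>" using null_sets_UN'[OF F'(2), of "\<lambda>U. U" \<mu>] by auto
  moreover have "{v \<in> space \<mu>. v \<notin> measure_support \<mu>} \<subseteq> \<Union>F'"
    unfolding F'(3) measure_support_def by (auto simp: zero_less_iff_neq_zero)
  ultimately show ?thesis by (rule AE_I')
qed

locale trade_environment =
  fixes V :: "real set" and \<mu> :: "real measure" and c :: "real \<Rightarrow> real"
  assumes env: "environment V \<mu> c"
begin

lemma compact_V: "compact V" and V_ne: "V \<noteq> {}" and Inf_lt_Sup: "Inf V < Sup V"
  and prob: "prob_space \<mu>" and sets_\<mu>: "sets \<mu> = sets borel" and supp: "measure_support \<mu> = V"
  and cont: "continuous_on V c" and gain: "v \<in> V \<Longrightarrow> c v \<le> v" and surplus_pos: "surplus V \<mu> c > 0"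
  using env unfolding environment_def by auto

sublocale prob_space \<mu> by (rule prob)

text \<open>The indicator makes the integrand Borel for any \<open>h\<close> continuous on
  \<open>V\<close>; as \<open>\<mu>\<close> is concentrated on \<open>V\<close>, it changes no
  expectation.\<close>

definition expect :: "(real \<Rightarrow> real) \<Rightarrow> real" where
  "expect h = (\<integral>v. indicator V v * h v \<partial>\<mu>)"

lemma AE_V: "AE v in \<mu>. v \<in> V"
  using AE_measure_support[OF sets_\<mu>] supp by simp

lemma V_bounds: "v \<in> V \<Longrightarrow> Inf V \<le> v" "v \<in> V \<Longrightarrow> v \<le> Sup V" "Inf V \<in> V" "Sup V \<in> V"
  using compact_imp_bounded[OF compact_V] closed_contains_Inf closed_contains_Sup compact_imp_closed[OF compact_V] V_ne
    bounded_imp_bdd_below bounded_imp_bdd_above cInf_lower cSup_upper by metis+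

lemma measurable_\<mu>: "h \<in> borel_measurable borel \<Longrightarrow> h \<in> borel_measurable \<mu>"
  by (simp add: measurable_cong_sets[OF sets_\<mu> refl])

lemma V_borel: "V \<in> sets borel"
  using compact_imp_closed[OF compact_V] by auto

lemma measurable_on_V:
  fixes h :: "real \<Rightarrow> real"
  assumes "continuous_on V h"
  shows "(\<lambda>v. indicator V v * h v) \<in> borel_measurable borel"
  using borel_measurable_continuous_on_indicator[OF V_borel assms] by simp

lemma integrable_weighted:
  fixes h :: "real \<Rightarrow> real"
  assumes l: "l \<in> borel_measurable borel" "\<And>v. \<bar>l v\<bar> \<le> B" and h: "continuous_on V h"
  shows "integrable \<mu> (\<lambda>v. l v * (indicator V v * h v))"
proof -
  have "compact (h ` V)" by (rule compact_continuous_image[OF h compact_V])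
  then have "bounded (h ` V)" by (rule compact_imp_bounded)
  then obtain K where "\<forall>y\<in>h ` V. norm y \<le> K" unfolding bounded_iff by blast
  then have K: "\<bar>h v\<bar> \<le> K" if "v \<in> V" for v using that by auto
  have K0: "0 \<le> K" using K[OF V_bounds(3)] by simp
  have B0: "0 \<le> B" using l(2)[of 0] by simp
  have "\<bar>indicator V v * h v\<bar> \<le> K" for v
    using K[of v] K0 by (auto simp: indicator_def)
  then have "\<bar>l v * (indicator V v * h v)\<bar> \<le> B * K" for v
    unfolding abs_mult[of "l v"] using l(2) B0 by (intro mult_mono) auto
  then show ?thesis
    using l(1) measurable_on_V[OF h]
    by (intro integrable_const_bound[where B = "B * K"] measurable_\<mu>) auto
qed

lemma integrable_expect:
  fixes h :: "real \<Rightarrow> real"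
  shows "continuous_on V h \<Longrightarrow> integrable \<mu> (\<lambda>v. indicator V v * h v)"
  using integrable_weighted[of "\<lambda>_. 1" 1 h] by simp

lemma expect_diff:
  "continuous_on V g \<Longrightarrow> continuous_on V h \<Longrightarrow> expect (\<lambda>v. g v - h v) = expect g - expect h"
  unfolding expect_def right_diff_distrib by (intro Bochner_Integration.integral_diff integrable_expect)

lemma expect_const: "expect (\<lambda>_. k) = k"
proof -
  have "expect (\<lambda>_. k) = (\<integral>v. k \<partial>\<mu>)"
    unfolding expect_def
  proof (rule integral_cong_AE)
    show "AE v in \<mu>. indicator V v * k = k" using AE_V by eventually_elim simp
  qed (auto intro!: measurable_\<mu> measurable_on_V continuous_intros)
  then show ?thesis by (simp add: prob_space)
qed

text \<open>An open set that meets the support \<open>V\<close> has positive mass, and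
  \<open>h\<close> is at least \<open>d\<close> almost everywhere on it.\<close>

lemma expect_pos:
  assumes h: "continuous_on V h" and nn: "\<And>v. v \<in> V \<Longrightarrow> 0 \<le> h v"
    and U: "open U" "U \<inter> V \<noteq> {}" and d: "d > 0" "\<And>v. v \<in> V \<inter> U \<Longrightarrow> d \<le> h v"
  shows "0 < expect h"
proof -
  obtain u where "u \<in> U" "u \<in> measure_support \<mu>" using U supp by auto
  then have "emeasure \<mu> U > 0" using U unfolding measure_support_def by blast
  then have mU: "measure \<mu> U > 0" by (simp add: emeasure_eq_measure)
  have Us: "U \<in> sets \<mu>" using U sets_\<mu> by auto
  then have "0 < (\<integral>v. d * indicator U v \<partial>\<mu>)"
    using mU d sets.sets_into_space[OF Us] by (simp add: Int_absorb2)
  also have "\<dots> \<le> expect h"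
    unfolding expect_def
  proof (rule integral_mono_AE)
    show "integrable \<mu> (\<lambda>v. d * indicator U v)"
      using Us by (intro integrable_mult_right integrable_real_indicator) (auto simp: emeasure_eq_measure)
    show "integrable \<mu> (\<lambda>v. indicator V v * h v)" by (rule integrable_expect[OF h])
    show "AE v in \<mu>. d * indicator U v \<le> indicator V v * h v"
      using AE_V by eventually_elim (use d nn in \<open>auto simp: indicator_def\<close>)
  qed
  finally show ?thesis .
qed

text \<open>\<open>Sup V\<close> lies in the support, so the values above the midpoint have positive
  mass.\<close>

lemma Inf_less_mean: "Inf V < expect (\<lambda>v. v)"
proof -
  have "Sup V \<in> {(Inf V + Sup V) / 2<..} \<inter> V" using V_bounds Inf_lt_Sup by auto
  then have ne: "{(Inf V + Sup V) / 2<..} \<inter> V \<noteq> {}" by blast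
  have "0 < expect (\<lambda>v. v - Inf V)"
    by (rule expect_pos[where U = "{(Inf V + Sup V) / 2<..}" and d = "(Sup V - Inf V) / 2"])
      (use ne V_bounds Inf_lt_Sup in \<open>auto intro!: continuous_intros simp: field_simps\<close>)
  then show ?thesis by (simp add: expect_diff expect_const continuous_on_id)
qed

lemma mean_less_Sup: "expect (\<lambda>v. v) < Sup V"
proof -
  have "Inf V \<in> {..<(Inf V + Sup V) / 2} \<inter> V" using V_bounds Inf_lt_Sup by auto
  then have ne: "{..<(Inf V + Sup V) / 2} \<inter> V \<noteq> {}" by blast
  have "0 < expect (\<lambda>v. Sup V - v)"
    by (rule expect_pos[where U = "{..<(Inf V + Sup V) / 2}" and d = "(Sup V - Inf V) / 2"])
      (use ne V_bounds Inf_lt_Sup in \<open>auto intro!: continuous_intros simp: field_simps\<close>)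
  then show ?thesis by (simp add: expect_diff expect_const continuous_on_id)
qed

lemma surplus_eq: "surplus V \<mu> c = expect (\<lambda>v. v) - expect c"
  unfolding surplus_def using expect_diff[OF continuous_on_id cont] by (simp add: expect_def)

lemma seller_min_eq: "seller_min V \<mu> c = max (Inf V - expect c) 0"
  by (simp add: seller_min_def expect_def)

lemma weighted_const:
  fixes l :: "real \<Rightarrow> real"
  assumes "l \<in> borel_measurable borel"
  shows "(\<integral>v. l v * (indicator V v * k) \<partial>\<mu>) = (\<integral>v. l v \<partial>\<mu>) * k"
proof -
  have "(\<integral>v. l v * (indicator V v * k) \<partial>\<mu>) = (\<integral>v. l v * k \<partial>\<mu>)"
    using AE_V V_borel assms by (intro integral_cong_AE measurable_\<mu>) (auto elim!: eventually_mono)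
  then show ?thesis by simp
qed

lemma weighted_mono:
  fixes l g h :: "real \<Rightarrow> real"
  assumes l: "l \<in> borel_measurable borel" "\<And>v. 0 \<le> l v" "\<And>v. l v \<le> 1"
    and "continuous_on V g" "continuous_on V h" and le: "\<And>v. v \<in> V \<Longrightarrow> g v \<le> h v"
  shows "(\<integral>v. l v * (indicator V v * g v) \<partial>\<mu>) \<le> (\<integral>v. l v * (indicator V v * h v) \<partial>\<mu>)"
proof (rule integral_mono)
  show "integrable \<mu> (\<lambda>v. l v * (indicator V v * g v))" "integrable \<mu> (\<lambda>v. l v * (indicator V v * h v))"
    using assms by (auto intro!: integrable_weighted[where B = 1])
  show "l v * (indicator V v * g v) \<le> l v * (indicator V v * h v)" for v
    using l(2)[of v] le[of v] by (auto simp: indicator_def intro: mult_left_mono)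
qed

text \<open>The weight is \<open>1\<close> near \<open>Inf V\<close> and a small positive constant elsewhere; positivity keeps the
  weighted mean off \<open>Inf V\<close> even if \<open>\<mu>\<close> has an atom there.\<close>

lemma low_weight:
  assumes m: "m > 0"
  obtains l L w where "l \<in> borel_measurable borel" "\<And>v. 0 \<le> l v" "\<And>v. l v \<le> 1"
    "L > 0" "(\<integral>v. l v \<partial>\<mu>) = L" "(\<integral>v. l v * (indicator V v * v) \<partial>\<mu>) = L * w"
    "Inf V < w" "w < Inf V + m"
proof -
  define a b where "a = Inf V" and "b = Sup V"
  have ab: "a < b" using Inf_lt_Sup by (simp add: a_def b_def)
  define U where "U = {..<a + m / 2}"
  have "a \<in> U" "a \<in> measure_support \<mu>" using m V_bounds supp by (auto simp: U_def a_def)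
  then have "emeasure \<mu> U > 0" unfolding measure_support_def by (auto simp: U_def)
  then have mU: "measure \<mu> U > 0" by (simp add: emeasure_eq_measure)
  have Us: "U \<in> sets \<mu>" using sets_\<mu> by (auto simp: U_def)
  \<comment> \<open>Chosen so that weight \<open>t\<close> on values up to \<open>b - a\<close>
    above \<open>a\<close> adds less than \<open>m / 2 * measure \<mu> U\<close>.\<close>
  define t where "t = min 1 (m * measure \<mu> U / (4 * (b - a)))"
  have t: "0 < t" "t \<le> 1" using m mU ab by (auto simp: t_def)
  have "t \<le> m * measure \<mu> U / (4 * (b - a))" by (simp add: t_def)
  then have "4 * (t * (b - a)) \<le> m * measure \<mu> U" using ab by (simp add: field_simps)
  moreover have "0 < m * measure \<mu> U" using m mU by simp
  ultimately have tb: "t * (b - a) < m / 2 * measure \<mu> U" by linarith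
  define l where "l v = (if v < a + m / 2 then 1 else t)" for v
  have lm: "l \<in> borel_measurable borel" unfolding l_def by measurable
  have l01: "0 \<le> l v" "l v \<le> 1" "t \<le> l v" for v using t by (auto simp: l_def)
  have lint: "integrable \<mu> l"
    using lm l01 by (intro integrable_const_bound[where B = 1] measurable_\<mu>) auto
  define L where "L = (\<integral>v. l v \<partial>\<mu>)"
  have LU: "measure \<mu> U \<le> L"
  proof -
    have "integrable \<mu> (indicator U :: real \<Rightarrow> real)"
      using Us by (intro integrable_real_indicator) (auto simp: emeasure_eq_measure)
    then have "(\<integral>v. indicator U v \<partial>\<mu>) \<le> L"
      unfolding L_def using lint t by (intro integral_mono) (auto simp: U_def l_def split: split_indicator)
    then show ?thesis using sets.sets_into_space[OF Us] by (simp add: Int_absorb2)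
  qed
  then have L: "L > 0" using mU by linarith
  have int: "integrable \<mu> (\<lambda>v. l v * (indicator V v * h v))" if "continuous_on V h" for h
    by (rule integrable_weighted[OF lm _ that, where B = 1]) (use l01 in auto)
  \<comment> \<open>\<open>D\<close> is \<open>L * (w - a)\<close> for the weighted mean
    \<open>w\<close>, so the goal is \<open>0 < D < m * L\<close>.\<close>
  define D where "D = (\<integral>v. l v * (indicator V v * (v - a)) \<partial>\<mu>)"
  have la: "(\<integral>v. l v * (indicator V v * a) \<partial>\<mu>) = L * a"
    unfolding L_def by (rule weighted_const[OF lm])
  have Dw: "(\<integral>v. l v * (indicator V v * v) \<partial>\<mu>) = D + L * a"
  proof -
    have "D = (\<integral>v. l v * (indicator V v * v) - l v * (indicator V v * a) \<partial>\<mu>)"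
      unfolding D_def by (simp add: right_diff_distrib)
    also have "\<dots> = (\<integral>v. l v * (indicator V v * v) \<partial>\<mu>) - (\<integral>v. l v * (indicator V v * a) \<partial>\<mu>)"
      using int[of "\<lambda>v. v"] int[of "\<lambda>v. a"] by (intro Bochner_Integration.integral_diff) (auto simp: continuous_on_id)
    finally show ?thesis using la by simp
  qed
  have ca: "continuous_on V (\<lambda>v. v - a)" by (intro continuous_intros)
  have "t * expect (\<lambda>v. v - a) \<le> D"
    unfolding D_def expect_def integral_mult_right_zero[symmetric]
    using int[OF ca] integrable_expect[OF ca] l01(3) V_bounds(1)
    by (intro integral_mono mult_right_mono) (auto simp: a_def split: split_indicator)
  moreover have "expect (\<lambda>v. v - a) > 0"
    using Inf_less_mean by (simp add: expect_diff expect_const continuous_on_id a_def)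
  ultimately have D0: "D > 0" using t by (meson less_le_trans mult_pos_pos)
  \<comment> \<open>On \<open>U\<close> the excess \<open>v - a\<close> is below
    \<open>m / 2\<close>; off \<open>U\<close> it is at most \<open>b - a\<close> but has weight
    \<open>t\<close>.\<close>
  have "D \<le> (\<integral>v. m / 2 * l v + t * (b - a) \<partial>\<mu>)"
    unfolding D_def
  proof (rule integral_mono_AE)
    show "integrable \<mu> (\<lambda>v. m / 2 * l v + t * (b - a))" using lint by simp
    show "AE v in \<mu>. l v * (indicator V v * (v - a)) \<le> m / 2 * l v + t * (b - a)"
      using AE_V
    proof eventually_elim
      case (elim v)
      have "v - a \<le> b - a" using V_bounds(2)[OF elim] by (simp add: b_def)
      then have "t * (v - a) \<le> t * (b - a)" using t by simp
      moreover have "0 \<le> t * (b - a)" "0 \<le> m / 2 * t" using t ab m by auto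
      ultimately show ?case using elim by (auto simp: l_def)
    qed
  qed (rule int[OF ca])
  also have "\<dots> = m / 2 * L + t * (b - a)"
    using lint by (simp add: L_def prob_space)
  also have "\<dots> < m / 2 * L + m / 2 * measure \<mu> U" using tb by simp
  also have "\<dots> \<le> m / 2 * L + m / 2 * L"
    using LU m by (intro add_left_mono mult_left_mono) auto
  finally have Dm: "D < m * L" by (simp add: mult.commute)
  show ?thesis
  proof (rule that[of l L "a + D / L"])
    show "(\<integral>v. l v * (indicator V v * v) \<partial>\<mu>) = L * (a + D / L)"
      using Dw L by (simp add: algebra_simps)
    show "Inf V < a + D / L" using D0 L by (simp add: a_def)
    show "a + D / L < Inf V + m" using Dm L by (simp add: a_def field_simps)
  qed (use lm l01 L L_def in auto)
qed

text \<open>Both low pairs get a multiple of the weight \<open>l\<close>, the pair (1,0) gets the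
  constant \<open>\<theta>\<close> and so keeps the prior means, and (2,1) gets the remainder. The
  last two equations are the resulting balance of values and costs;
  \<open>2 * s \<le> (1 - \<theta>) * L\<close> keeps the remainder nonnegative.\<close>

lemma chain_structure_exists:
  assumes l: "l \<in> borel_measurable borel" "\<And>v. 0 \<le> l v" "\<And>v. l v \<le> 1"
    and L: "L > 0" "(\<integral>v. l v \<partial>\<mu>) = L"
    and w: "(\<integral>v. l v * (indicator V v * v) \<partial>\<mu>) = L * w"
    and cl: "(\<integral>v. l v * (indicator V v * c v) \<partial>\<mu>) = L * cl"
    and s: "s > 0" "2 * s \<le> (1 - \<theta>) * L" and \<theta>: "\<theta> > 0"
    and r: "r = 1 - \<theta> - 2 * s" "r > 0"
    and p2: "r * p2 = (1 - \<theta>) * expect (\<lambda>v. v) - 2 * s * w"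
    and cr: "r * cr = (1 - \<theta>) * expect c - 2 * s * cl"
  shows "\<exists>P. info_structure \<mu> {0,1,2} {0,1} P \<and>
     chain_structure V c P s \<theta> r w (expect (\<lambda>v. v)) p2 cl (expect c) cr"
proof -
  \<comment> \<open>This scale gives \<open>u * l\<close> the total mass \<open>s\<close>.\<close>
  define u where "u = s / L"
  have u: "u > 0" "u * L = s" using s L by (auto simp: u_def)
  have "2 * u * L \<le> (1 - \<theta>) * L" using s(2) u(2) by simp
  then have u2: "2 * u \<le> 1 - \<theta>" using L by simp
  define f where "f = (\<lambda>(k::nat \<times> nat) v. if k = (0,0) \<or> k = (1,1) then u * l v else if k = (1,0) then \<theta>
     else if k = (2,1) then 1 - \<theta> - 2 * u * l v else 0)"
  have fm: "f k \<in> borel_measurable borel" for k unfolding f_def using l by simp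
  have fnn: "f k v \<ge> 0" for k v
  proof -
    have "2 * u * l v \<le> 2 * u * 1" using u l by (intro mult_left_mono) auto
    then have "2 * u * l v \<le> 1 - \<theta>" using u2 by linarith
    moreover have "0 \<le> u * l v" using u l by simp
    ultimately show ?thesis unfolding f_def using \<theta> by auto
  qed
  have fnull: "f k v = 0" if "k \<notin> {0,1,2} \<times> {0,1}" for k v
    using that by (auto simp: f_def)
  have fsum: "(\<Sum>k\<in>{0,1,2} \<times> {0,1}. f k v) = 1" for v
    by (simp add: f_def flip: sum.cartesian_product')
  let ?P = "signal_density \<mu> f"
  note hyps = prob sets_\<mu> fm fnn _ _ fnull fsum
  have lint: "integrable \<mu> l"
    using l by (intro integrable_const_bound[where B = 1] measurable_\<mu>) auto
  have sp: "sig_prob ?P ts tb = (\<integral>v. f (ts, tb) v \<partial>\<mu>)" for ts tb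
    by (rule sig_prob_signal_density[OF hyps]) auto
  have ce: "cond_exp V ?P h ts tb = (\<integral>v. f (ts, tb) v * (indicator V v * h v) \<partial>\<mu>) / (\<integral>v. f (ts, tb) v \<partial>\<mu>)"
    if "continuous_on V h" for h ts tb
    by (rule cond_exp_signal_density[OF hyps measurable_on_V[OF that]]) auto
  have f0: "(\<integral>v. f (0,0) v \<partial>\<mu>) = s" "(\<integral>v. f (Suc 0,0) v \<partial>\<mu>) = \<theta>" "(\<integral>v. f (Suc 0,Suc 0) v \<partial>\<mu>) = s"
    "(\<integral>v. f (2,Suc 0) v \<partial>\<mu>) = r" "(\<integral>v. f (2,0) v \<partial>\<mu>) = 0" "(\<integral>v. f (0,Suc 0) v \<partial>\<mu>) = 0"
    using lint u L r by (simp_all add: f_def prob_space)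
  have fh: "(\<integral>v. f (0,0) v * (indicator V v * h v) \<partial>\<mu>) = s * hl"
    "(\<integral>v. f (Suc 0,0) v * (indicator V v * h v) \<partial>\<mu>) = \<theta> * expect h"
    "(\<integral>v. f (Suc 0,Suc 0) v * (indicator V v * h v) \<partial>\<mu>) = s * hl"
    "(\<integral>v. f (2,Suc 0) v * (indicator V v * h v) \<partial>\<mu>) = (1 - \<theta>) * expect h - 2 * s * hl"
    if h: "continuous_on V h" and hl: "(\<integral>v. l v * (indicator V v * h v) \<partial>\<mu>) = L * hl" for h hl
  proof -
    have int: "integrable \<mu> (\<lambda>v. l v * (indicator V v * h v))"
      by (rule integrable_weighted[OF l(1) _ h, where B = 1]) (use l in auto)
    show "(\<integral>v. f (0,0) v * (indicator V v * h v) \<partial>\<mu>) = s * hl"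
      "(\<integral>v. f (Suc 0,Suc 0) v * (indicator V v * h v) \<partial>\<mu>) = s * hl"
      using hl u(2) by (simp_all add: f_def mult.assoc flip: u(2))
    show "(\<integral>v. f (Suc 0,0) v * (indicator V v * h v) \<partial>\<mu>) = \<theta> * expect h"
      by (simp add: f_def expect_def)
    have "(\<integral>v. f (2,Suc 0) v * (indicator V v * h v) \<partial>\<mu>)
       = (\<integral>v. (1 - \<theta>) * (indicator V v * h v) - 2 * u * (l v * (indicator V v * h v)) \<partial>\<mu>)"
      by (intro Bochner_Integration.integral_cong) (auto simp: f_def algebra_simps)
    also have "\<dots> = (1 - \<theta>) * expect h - 2 * u * (L * hl)"
      using int integrable_expect[OF h] by (subst Bochner_Integration.integral_diff) (auto simp: expect_def hl)
    finally show "(\<integral>v. f (2,Suc 0) v * (indicator V v * h v) \<partial>\<mu>) = (1 - \<theta>) * expect h - 2 * s * hl"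
      using u(2) by (simp add: mult.assoc flip: u(2))
  qed
  have "info_structure \<mu> {0,1,2} {0,1} ?P"
    by (rule info_structure_signal_density[OF hyps]) auto
  moreover have "chain_structure V c ?P s \<theta> r w (expect (\<lambda>v. v)) p2 cl (expect c) cr"
    by unfold_locales
      (use s \<theta> r in \<open>simp_all add: sp f0 ce[OF continuous_on_id] ce[OF cont] fh[OF continuous_on_id w] fh[OF cont cl] flip: p2 cr\<close>)
  ultimately show ?thesis by blast
qed

end


section \<open>Approximating every payoff pair\<close>

text \<open>The least grid price above \<open>y\<close> and the greatest one not above
  \<open>y\<close> are consecutive, hence at most \<open>\<Delta>\<close> apart; both exist because
  the grid spans \<open>V\<close>.\<close>

lemma price_grid_point:
  assumes G: "price_grid \<Delta> V G" and y: "Inf V \<le> y" "y < Sup V"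
  obtains p where "p \<in> G" "y < p" "p \<le> y + \<Delta>"
proof -
  have fin: "finite G" "G \<noteq> {}" and mm: "Min G \<le> y" "y < Max G"
    and step: "\<And>p p'. p \<in> G \<Longrightarrow> p' \<in> G \<Longrightarrow> p < p' \<Longrightarrow> \<not> (\<exists>r\<in>G. p < r \<and> r < p') \<Longrightarrow> p' - p \<le> \<Delta>"
    using G y unfolding price_grid_def by auto
  let ?A = "{p \<in> G. y < p}" and ?B = "{p \<in> G. p \<le> y}"
  have "Max G \<in> ?A" "Min G \<in> ?B" using mm Max_in[OF fin] Min_in[OF fin] by auto
  then have A: "finite ?A" "?A \<noteq> {}" and B: "finite ?B" "?B \<noteq> {}"
    using fin(1) by auto
  have a: "Min ?A \<in> ?A" and b: "Max ?B \<in> ?B" using Min_in[OF A] Max_in[OF B] by auto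
  have "\<not> (\<exists>r\<in>G. Max ?B < r \<and> r < Min ?A)"
  proof
    assume "\<exists>r\<in>G. Max ?B < r \<and> r < Min ?A"
    then obtain r where r: "r \<in> G" "Max ?B < r" "r < Min ?A" by blast
    show False
    proof (cases "r \<le> y")
      case True then show False using Max_ge[OF B(1), of r] r by auto
    next
      case False then show False using Min_le[OF A(1), of r] r by auto
    qed
  qed
  then have "Min ?A - Max ?B \<le> \<Delta>" using a b by (intro step) auto
  then show ?thesis using a b by (intro that[of "Min ?A"]) auto
qed

text \<open>With \<open>D = Ev - p1\<close> the buyer's payoff in the mixed equilibrium is
  \<open>x * D + (1 - x) * (\<theta> * D - 2 * s * (p1 - w))\<close>, which is close to \<open>x * D\<close>.\<close>

lemma buyer_payoff_approx:
  fixes D \<pi> \<delta> H \<theta> E :: real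
  assumes D: "0 < D" "D \<le> H" and \<delta>: "0 < \<delta>" and \<theta>: "0 < \<theta>" "\<theta> < 1/2" "\<theta> * H \<le> \<delta>"
    and E: "0 \<le> E" "E \<le> \<delta>" and \<pi>: "0 \<le> \<pi>" "\<pi> \<le> D + 3 * \<delta>"
  obtains x where "\<theta> \<le> x" "x < 1" "\<bar>\<pi> - (x * D + (1 - x) * (\<theta> * D - E))\<bar> \<le> 5 * \<delta>"
proof -
  \<comment> \<open>The ideal weight \<open>\<pi> / D\<close> is clipped to
    \<open>[\<theta>, 1 - \<theta>]\<close>. This moves \<open>x * D\<close> by at most
    \<open>\<theta> * D \<le> \<delta>\<close>, besides the \<open>3 * \<delta>\<close> by which
    \<open>\<pi>\<close> may exceed \<open>D\<close>.\<close>
  define x where "x = max \<theta> (min (1 - \<theta>) (\<pi> / D))"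
  have x: "\<theta> \<le> x" "x \<le> 1 - \<theta>" using \<theta> by (auto simp: x_def)
  have "\<theta> * D \<le> \<theta> * H" using \<theta> D by (intro mult_left_mono) auto
  then have \<theta>D: "\<theta> * D \<le> \<delta>" "0 \<le> \<theta> * D" using \<theta> D by (linarith, simp)
  have xD: "x * D = max (\<theta> * D) (min (D - \<theta> * D) \<pi>)"
  proof -
    have "x * D = max (\<theta> * D) (min ((1 - \<theta>) * D) (\<pi> / D * D))"
      unfolding x_def using D by (simp add: max_mult_distrib_right min_mult_distrib_right)
    then show ?thesis using D by (simp add: algebra_simps)
  qed
  have "\<bar>(1 - x) * (\<theta> * D - E)\<bar> \<le> 1 * \<delta>"
    unfolding abs_mult using x \<theta> \<theta>D E by (intro mult_mono) auto
  moreover have "2 * (\<theta> * D) \<le> D" using \<theta> D mult_right_mono[of "2 * \<theta>" 1 D] by simp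
  then have "\<bar>\<pi> - x * D\<bar> \<le> 4 * \<delta>"
    unfolding xD using \<theta>D \<pi> \<delta> by linarith
  ultimately show ?thesis using x \<theta> by (intro that[of x]) auto
qed

context trade_environment
begin

lemma eps_net_exists:
  assumes \<epsilon>: "\<epsilon> > 0"
  shows "\<exists>\<Delta>>0. \<forall>G. price_grid \<Delta> V G \<longrightarrow>
           (\<exists>Ts Tb P. info_structure \<mu> Ts Tb P \<and>
              eps_net (SE_payoffs V c P Ts Tb G)
                {(\<pi>b, \<pi>s). \<pi>b \<ge> 0 \<and> \<pi>s \<ge> seller_min V \<mu> c \<and> \<pi>b + \<pi>s \<le> surplus V \<mu> c} \<epsilon>)"
proof -

  \<comment> \<open>Constants that do not depend on the grid\<close>
  define a b Ev Ec where "a = Inf V" and "b = Sup V" and "Ev = expect (\<lambda>v. v)" and "Ec = expect c"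
  have aEv: "a < Ev" and Evb: "Ev < b" and EcEv: "Ec < Ev"
    using Inf_less_mean mean_less_Sup surplus_pos surplus_eq by (auto simp: a_def b_def Ev_def Ec_def)
  \<comment> \<open>\<open>low - Ec\<close> equals \<open>seller_min\<close>, so prices from
    \<open>low\<close> to \<open>Ev\<close> correspond to the seller payoffs in the target set, and
    \<open>H\<close> is the length of that range.\<close>
  define low where "low = max a Ec"
  define H where "H = Ev - low"
  have H: "H > 0" using aEv EcEv by (simp add: H_def low_def)
  \<comment> \<open>The total error will be \<open>8 * \<delta>\<close>, and
    \<open>10 * \<delta> \<le> H\<close> leaves room for \<open>p1\<close> between
    \<open>low + \<delta>\<close> and \<open>Ev - \<delta>\<close>.\<close>
  define \<delta> where "\<delta> = min \<epsilon> H / 10"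
  have \<delta>: "\<delta> > 0" "10 * \<delta> \<le> \<epsilon>" "10 * \<delta> \<le> H"
    using \<epsilon> H unfolding \<delta>_def by (simp, linarith, linarith)
  define \<theta> where "\<theta> = \<delta> / H"
  have \<theta>: "\<theta> > 0" "\<theta> \<le> 1 / 10" "\<theta> * H = \<delta>" using \<delta> H by (auto simp: \<theta>_def field_simps)
  obtain l L w where l: "l \<in> borel_measurable borel" "\<And>v. 0 \<le> l v" "\<And>v. l v \<le> 1"
    and L: "L > 0" "(\<integral>v. l v \<partial>\<mu>) = L" and lw: "(\<integral>v. l v * (indicator V v * v) \<partial>\<mu>) = L * w"
    and w: "a < w" "w < a + \<delta>"
    by (rule low_weight[OF \<delta>(1), folded a_def]) (rule that)
  define cl where "cl = (\<integral>v. l v * (indicator V v * c v) \<partial>\<mu>) / L"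
  have lcl: "(\<integral>v. l v * (indicator V v * c v) \<partial>\<mu>) = L * cl" using L by (simp add: cl_def)
  have "L * cl \<le> L * w"
    unfolding lcl[symmetric] lw[symmetric] by (rule weighted_mono[OF l cont continuous_on_id gain])
  then have clw: "cl \<le> w" using L by simp
  have "compact (c ` V)" by (rule compact_continuous_image[OF cont compact_V])
  then have "bounded (c ` V)" by (rule compact_imp_bounded)
  then obtain B where "\<forall>y\<in>c ` V. norm y \<le> B" unfolding bounded_iff by blast
  then have B: "- B \<le> c v" if "v \<in> V" for v using that by force
  have "(\<integral>v. l v * (indicator V v * - B) \<partial>\<mu>) \<le> (\<integral>v. l v * (indicator V v * c v) \<partial>\<mu>)"
    by (rule weighted_mono[OF l continuous_on_const cont B])
  then have "L * - B \<le> L * cl" unfolding weighted_const[OF l(1)] L(2) lcl .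
  then have clB: "- B \<le> cl" using L(1) by (simp only: mult_le_cancel_left_pos)
  \<comment> \<open>\<open>K\<close> bounds \<open>p1 - w\<close>, \<open>p2 - p1\<close> and
    \<open>p1 - cl\<close> for every grid, so that \<open>\<Delta>\<close> can be fixed before the
    grid is known.\<close>
  define K where "K = max (b - a) (b + B)"
  have K: "K > 0" "b - a \<le> K" "b - cl \<le> K" using aEv Evb clB by (auto simp: K_def)
  \<comment> \<open>In order, the four bounds give a grid price between \<open>a\<close> and
    \<open>w\<close>, keep rounding errors below \<open>\<delta>\<close>, yield
    \<open>s \<le> L / 4\<close>, and yield
    \<open>s * K \<le> \<theta> * \<delta> / 4\<close>.\<close>
  define \<Delta> where "\<Delta> = Min {(w - a) / 2, \<delta> / 2, \<delta> * L / 4, \<theta> * \<delta> * \<delta> / (4 * K)}"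
  have \<Delta>0: "\<Delta> > 0" using w(1) \<delta>(1) L(1) \<theta>(1) K(1) unfolding \<Delta>_def by simp
  have "\<Delta> \<le> (w - a) / 2" "\<Delta> \<le> \<delta> / 2" "\<Delta> \<le> \<delta> * L / 4" "\<Delta> \<le> \<theta> * \<delta> * \<delta> / (4 * K)"
    unfolding \<Delta>_def by (rule Min_le; simp)+
  then have \<Delta>: "2 * \<Delta> \<le> w - a" "2 * \<Delta> \<le> \<delta>" "\<Delta> \<le> \<delta> * L / 4" "\<Delta> \<le> \<theta> * \<delta> * \<delta> / (4 * K)"
    by simp_all
  let ?Y = "{(\<pi>b, \<pi>s). \<pi>b \<ge> 0 \<and> \<pi>s \<ge> seller_min V \<mu> c \<and> \<pi>b + \<pi>s \<le> surplus V \<mu> c}"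

  \<comment> \<open>The signal structure for a given grid\<close>
  have "\<exists>Ts Tb P. info_structure \<mu> Ts Tb P \<and> eps_net (SE_payoffs V c P Ts Tb G) ?Y \<epsilon>"
    if G: "price_grid \<Delta> V G" for G
  proof -
    have fin: "finite G" using G by (simp add: price_grid_def)
    \<comment> \<open>Since \<open>g\<close> lies above \<open>Inf V\<close>, the seller's guarantee
      reaches \<open>seller_min\<close> exactly and not just up to an error.\<close>
    obtain g where g: "g \<in> G" "a < g" "g \<le> a + \<Delta>"
      using price_grid_point[OF G, of a] aEv Evb unfolding a_def b_def by auto
    have gw: "g < w" using g(3) \<Delta>(1) w(1) by linarith
    obtain p2 where p2: "p2 \<in> G" "Ev < p2" "p2 \<le> Ev + \<Delta>"
      using price_grid_point[OF G, of Ev] aEv Evb unfolding a_def b_def by auto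
    have low: "a \<le> low" "Ec \<le> low" by (auto simp: low_def)
    have Evw: "9 * \<delta> \<le> Ev - w" using w \<delta> low by (simp add: H_def)
    \<comment> \<open>Taking mass \<open>2 * s\<close> with mean \<open>w\<close> out of mass
      \<open>1 - \<theta>\<close> with mean \<open>Ev\<close> has to leave mean exactly
      \<open>p2\<close>. As \<open>p2 - Ev \<le> \<Delta>\<close>, this forces \<open>s\<close> to
      be small.\<close>
    define s where "s = (1 - \<theta>) * (p2 - Ev) / (p2 - w) / 2"
    have p2w: "p2 - w > 0" using Evw p2 \<delta> by linarith
    have s: "s > 0" using \<theta> p2 p2w by (simp add: s_def)
    have "2 * (z / d / 2) * d = z" if "d > 0" for z d :: real using that by simp
    from this[OF p2w] have s_eq: "2 * s * (p2 - w) = (1 - \<theta>) * (p2 - Ev)" unfolding s_def .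
    have s\<delta>: "s * \<delta> \<le> \<Delta>"
    proof -
      have "s * \<delta> \<le> s * (p2 - w)" using s Evw p2 \<delta> by (intro mult_left_mono) auto
      also have "\<dots> = (1 - \<theta>) * (p2 - Ev) / 2" using s_eq by simp
      also have "\<dots> \<le> 1 * (p2 - Ev) / 2" using \<theta> p2 by (intro divide_right_mono mult_right_mono) auto
      also have "\<dots> \<le> \<Delta>" using p2 by simp
      finally show ?thesis .
    qed
    have "s * \<delta> \<le> L / 4 * \<delta>" using s\<delta> \<Delta>(3) by (simp add: mult.commute)
    then have sL: "s \<le> L / 4" using \<delta> by simp
    have "s * \<delta> \<le> \<theta> * \<delta> / (4 * K) * \<delta>" using s\<delta> \<Delta>(4) by simp
    then have "s \<le> \<theta> * \<delta> / (4 * K)" using \<delta>(1) by (rule mult_right_le_imp_le)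
    then have sK: "s * K \<le> \<theta> * \<delta> / 4" using K by (simp add: field_simps)
    have \<theta>\<delta>: "\<theta> * \<delta> \<le> \<delta> / 10" "0 < \<theta> * \<delta>"
      using \<theta> \<delta> mult_right_mono[of \<theta> "1/10" \<delta>] by auto
    define r where "r = 1 - \<theta> - 2 * s"
    have "2 * s * (p2 - w) < (1 - \<theta>) * (p2 - w)"
      unfolding s_eq using \<theta> Evw \<delta> by (intro mult_strict_left_mono) auto
    then have r: "r > 0" using p2w by (simp add: r_def)
    define cr where "cr = ((1 - \<theta>) * Ec - 2 * s * cl) / r"
    have rcr: "r * cr = (1 - \<theta>) * Ec - 2 * s * cl" using r by (simp add: cr_def)
    have rp2: "r * p2 = (1 - \<theta>) * Ev - 2 * s * w" using s_eq by (simp add: r_def algebra_simps)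
    have "2 * s \<le> (1 - \<theta>) * L"
    proof -
      have "1 / 2 * L \<le> (1 - \<theta>) * L" using \<theta> L by (intro mult_right_mono) auto
      then show ?thesis using sL by simp
    qed
    then obtain P where info: "info_structure \<mu> {0,1,2} {0,1} P"
      and ch: "chain_structure V c P s \<theta> r w Ev p2 cl Ec cr"
      using chain_structure_exists[OF l L lw lcl s _ \<theta>(1) r_def r _ _] rp2 rcr
      unfolding Ev_def Ec_def by blast
    interpret chain_structure V c P s \<theta> r w Ev p2 cl Ec cr by (rule ch)
    \<comment> \<open>\<open>r * (p - cr)\<close> is \<open>(1 - \<theta>) * (p - Ec)\<close>, at
      least \<open>\<delta> / 2\<close>, minus \<open>2 * s * (p - cl)\<close>, at most
      \<open>\<delta> / 2\<close>.\<close>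
    have cr_le: "cr \<le> p" if p: "low + \<delta> \<le> p" "p \<le> Ev" for p
    proof -
      have "s * (p - cl) \<le> s * K" using s p Evb K by (intro mult_left_mono) auto
      then have 1: "2 * s * (p - cl) \<le> \<delta> / 2" using sK \<theta>\<delta> by simp
      have "\<delta> / 2 \<le> (1 / 2) * (p - Ec)" using p low by simp
      also have "\<dots> \<le> (1 - \<theta>) * (p - Ec)" using \<theta> p low \<delta> by (intro mult_right_mono) auto
      finally have "0 \<le> (1 - \<theta>) * (p - Ec) - 2 * s * (p - cl)" using 1 by simp
      also have "\<dots> = r * p - r * cr" unfolding rcr by (simp add: r_def algebra_simps)
      finally have "r * cr \<le> r * p" by simp
      then show ?thesis using r by simp
    qed
    have crp2: "cr \<le> p2" using cr_le[of Ev] p2 \<delta> by (simp add: H_def)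

    \<comment> \<open>Equilibrium payoffs lie in the target set\<close>
    have sub: "SE_payoffs V c P {0,1,2} {0,1} G \<subseteq> ?Y"
    proof (clarify, intro conjI)
      fix \<pi>b \<pi>s assume y: "(\<pi>b, \<pi>s) \<in> SE_payoffs V c P {0,1,2} {0,1} G"
      have 1: "(\<Sum>ts\<in>{0,1,2}. \<Sum>tb\<in>{0,1}. sig_prob P ts tb) = 1"
        by (simp add: sig r_def)
      have 2: "(\<Sum>ts\<in>{0,1,2}. \<Sum>tb\<in>{0,1}. sig_prob P ts tb * cond_exp V P (\<lambda>v. v) ts tb) = Ev"
        using rp2 by (simp add: sig val algebra_simps)
      have 3: "(\<Sum>ts\<in>{0,1,2}. \<Sum>tb\<in>{0,1}. sig_prob P ts tb * cond_exp V P c ts tb) = Ec"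
        using rcr by (simp add: sig cost algebra_simps)
      have 4: "cond_exp V P c ts tb \<le> cond_exp V P (\<lambda>v. v) ts tb \<and>
          g < cond_exp V P (\<lambda>v. v) ts tb \<and> cond_exp V P c ts tb \<le> p2"
        if "ts \<in> {0,1,2}" "tb \<in> {0,1}" "sig_prob P ts tb > 0" for ts tb
        using that clw gw EcEv p2 Evw \<delta> crp2 by (auto simp: sig val cost)
      \<comment> \<open>\<open>p2\<close> serves as the price that no conditional cost
        exceeds.\<close>
      note bounds = SE_payoffs_bounds[OF _ _ fin g(1) p2(1) y 1 2 3]
      show "0 \<le> \<pi>b" by (rule bounds(1)) (use 4 in auto)
      have "0 \<le> \<pi>s" by (rule bounds(2)) (use 4 in auto)
      moreover have "g - Ec \<le> \<pi>s" by (rule bounds(3)) (use 4 in auto)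
      ultimately show "seller_min V \<mu> c \<le> \<pi>s"
        using g by (simp add: seller_min_eq a_def Ec_def)
      have "\<pi>b + \<pi>s \<le> Ev - Ec" by (rule bounds(4)) (use 4 in auto)
      then show "\<pi>b + \<pi>s \<le> surplus V \<mu> c" by (simp add: surplus_eq Ev_def Ec_def)
    qed

    \<comment> \<open>Approximation of a target pair\<close>
    have "\<exists>z\<in>SE_payoffs V c P {0,1,2} {0,1} G. dist (\<pi>b, \<pi>s) z < \<epsilon>"
      if y: "0 \<le> \<pi>b" "seller_min V \<mu> c \<le> \<pi>s" "\<pi>b + \<pi>s \<le> surplus V \<mu> c" for \<pi>b \<pi>s
    proof -
      have y1: "low - Ec \<le> \<pi>s" "\<pi>b + \<pi>s \<le> Ev - Ec"
        using y by (auto simp: seller_min_eq surplus_eq low_def a_def Ec_def Ev_def)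
      \<comment> \<open>The price \<open>\<pi>s + Ec\<close> would give the seller exactly
        \<open>\<pi>s\<close>. It lies between \<open>low\<close> and \<open>Ev\<close>; clipping
        moves it by at most \<open>2 * \<delta>\<close>, and rounding up to the grid by at most
        \<open>\<Delta>\<close>.\<close>
      define y' where "y' = max (low + \<delta>) (min (\<pi>s + Ec) (Ev - 2 * \<delta>))"
      have y': "low + \<delta> \<le> y'" "y' \<le> Ev - 2 * \<delta>" "\<bar>y' - (\<pi>s + Ec)\<bar> \<le> 2 * \<delta>"
        using \<delta> y y1 H_def by (auto simp: y'_def)
      obtain p1 where p1: "p1 \<in> G" "y' < p1" "p1 \<le> y' + \<Delta>"
        using price_grid_point[OF G, of y'] y' low Evb \<delta> unfolding a_def b_def by auto
      have p1': "low + \<delta> \<le> p1" "p1 \<le> Ev - \<delta>" "\<bar>p1 - (\<pi>s + Ec)\<bar> \<le> 3 * \<delta>"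
        using y' p1 \<Delta>(2) \<delta> by auto
      define D where "D = Ev - p1"
      have D: "\<delta> \<le> D" "D \<le> H" using p1' \<delta> by (auto simp: D_def H_def)
      have lt: "w < p1" "p1 < p2" using w p1' low p2 \<delta> by auto
      have crp1: "cr \<le> p1" using cr_le[of p1] p1' \<delta> by simp
      have sp1: "s * (p1 - w) \<le> s * K"
        using s K p1' Evb w \<delta> by (intro mult_left_mono) auto
      define E where "E = 2 * (s * (p1 - w))"
      have E: "0 \<le> E" "E \<le> \<delta>" using s lt sp1 sK \<theta>\<delta> unfolding E_def by (simp, linarith)
      obtain x where x: "\<theta> \<le> x" "x < 1" "\<bar>\<pi>b - (x * D + (1 - x) * (\<theta> * D - E))\<bar> \<le> 5 * \<delta>"
      proof (rule buyer_payoff_approx[of D H \<delta> \<theta> E \<pi>b])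
        show "\<pi>b \<le> D + 3 * \<delta>" using y1 p1'(3) unfolding D_def by linarith
      qed (use D \<delta> \<theta> E y in auto)
      \<comment> \<open>The balance \<open>rp2\<close> with \<open>r * p1\<close> subtracted; it
        turns the payoff formula into \<open>x * D + (1 - x) * (\<theta> * D - E)\<close>.\<close>
      have rD: "r * (p2 - p1) = D - \<theta> * D + E"
        using rp2 by (simp add: E_def D_def r_def algebra_simps)
      \<comment> \<open>Here \<open>\<theta> \<le> x\<close> matters: type 2 posts \<open>p1\<close>
        often enough to outweigh the low pair in the belief of buyer type 1.\<close>
      have b1: "s * (p1 - w) \<le> r * x * (p2 - p1)"
      proof -
        have "s * (p1 - w) \<le> \<theta> * (\<delta> / 2)" using sp1 sK \<theta>\<delta> by linarith
        also have "\<dots> \<le> x * (\<delta> / 2)" using x \<delta> by (intro mult_right_mono) auto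
        also have "\<dots> \<le> x * (r * (p2 - p1))"
        proof (rule mult_left_mono)
          have "\<theta> * D \<le> 1 / 10 * D" using \<theta> D \<delta> by (intro mult_right_mono) auto
          then show "\<delta> / 2 \<le> r * (p2 - p1)" unfolding rD using D E \<delta> by linarith
        qed (use x \<theta> in simp)
        finally show ?thesis by (simp add: mult_ac)
      qed
      have b0: "s * (p1 - w) \<le> \<theta> * (Ev - p1)"
      proof -
        have "s * (p1 - w) \<le> \<theta> * \<delta>" using sp1 sK \<theta>\<delta> by linarith
        also have "\<dots> \<le> \<theta> * (Ev - p1)" using \<theta> p1' by (intro mult_left_mono) auto
        finally show ?thesis .
      qed
      have dev: "s * (p2 - p1) \<le> \<theta> * (p1 - Ec)"
      proof -
        have "s * (p2 - p1) \<le> s * K"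
          using s K p2 \<Delta>(2) p1' low Evb \<delta> by (intro mult_left_mono) auto
        also have "\<dots> \<le> \<theta> * \<delta>" using sK \<theta>\<delta> by simp
        also have "\<dots> \<le> \<theta> * (p1 - Ec)" using \<theta> p1' low by (intro mult_left_mono) auto
        finally show ?thesis .
      qed
      define q where "q = (p1 - cr) / (p2 - cr)"
      let ?\<sigma> = "mix_seller p1 p2 x" and ?\<beta> = "mix_buyer p1 p2 q w"
      have "sequential_equilibrium V c P {0,1,2} {0,1} G ?\<sigma> ?\<beta> (mix_belief P p1 p2 x)"
        by (rule mix_sequential_equilibrium[OF fin p1(1) p2(1) _ x(2) lt clw crp1 _ b0 b1 dev q_def])
          (use x \<theta> p1' low \<delta> in auto)
      then have mem: "(buyer_payoff V P {0,1,2} {0,1} G ?\<sigma> ?\<beta>, seller_payoff V c P {0,1,2} {0,1} G ?\<sigma> ?\<beta>)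
          \<in> SE_payoffs V c P {0,1,2} {0,1} G"
        unfolding SE_payoffs_def by blast
      note pay = mix_payoffs[OF fin p1(1) p2(1) lt crp1 q_def, of x]
      have "buyer_payoff V P {0,1,2} {0,1} G ?\<sigma> ?\<beta> = - E + \<theta> * D + x * (r * (p2 - p1))"
        unfolding pay(1) by (simp add: E_def D_def algebra_simps)
      also have "\<dots> = x * D + (1 - x) * (\<theta> * D - E)"
        unfolding rD by (simp add: algebra_simps)
      finally have bp: "\<bar>\<pi>b - buyer_payoff V P {0,1,2} {0,1} G ?\<sigma> ?\<beta>\<bar> \<le> 5 * \<delta>" using x by simp
      have "seller_payoff V c P {0,1,2} {0,1} G ?\<sigma> ?\<beta> = p1 - Ec"
        unfolding pay(2) rcr by (simp add: r_def algebra_simps)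
      then have "\<bar>\<pi>s - seller_payoff V c P {0,1,2} {0,1} G ?\<sigma> ?\<beta>\<bar> \<le> 3 * \<delta>" using p1' by simp
      then have "dist (\<pi>b, \<pi>s) (buyer_payoff V P {0,1,2} {0,1} G ?\<sigma> ?\<beta>, seller_payoff V c P {0,1,2} {0,1} G ?\<sigma> ?\<beta>) \<le> 5 * \<delta> + 3 * \<delta>"
        using bp unfolding dist_Pair_Pair dist_real_def
        by (intro order_trans[OF sqrt_sum_squares_le_sum_abs] add_mono) auto
      also have "\<dots> < \<epsilon>" using \<delta> by simp
      finally show ?thesis using mem by blast
    qed
    then have "eps_net (SE_payoffs V c P {0,1,2} {0,1} G) ?Y \<epsilon>"
      unfolding eps_net_def using sub by blast
    then show ?thesis using info by blast
  qed
  then show ?thesis using \<Delta>0 by blast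
qed

end

theorem mainTheorem2:
  fixes V :: "real set" and \<mu> :: "real measure" and c :: "real \<Rightarrow> real" and \<epsilon> :: real
  assumes "environment V \<mu> c" and "\<epsilon> > 0"
  shows "\<exists>\<Delta>>0. \<forall>G. price_grid \<Delta> V G \<longrightarrow>
           (\<exists>Ts Tb P. info_structure \<mu> Ts Tb P \<and>
              eps_net (SE_payoffs V c P Ts Tb G)
                {(\<pi>b, \<pi>s). \<pi>b \<ge> 0 \<and> \<pi>s \<ge> seller_min V \<mu> c \<and> \<pi>b + \<pi>s \<le> surplus V \<mu> c} \<epsilon>)"
  using trade_environment.eps_net_exists[OF trade_environment.intro[OF assms(1)] assms(2)] .

end
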